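(* For integers $a,b\ge1$ put $m=2^{a}3^{b}-1$ and $p=p(a,b)=3m(m+1)+1$, and consider the primes $p$ of this form. (1) The fixed pair $(w_2,w_3)=(5,7)$ is not a valid pair of Pocklington witnesses for all primes $p(a,b)$ with $a,b\ge1$. (2) For $p=p(a,b)$ prime, the validity of the pair $(5,7)$ is the conjunction of the two conditions $a-b\equiv 1$ or $2\pmod 4$ and $m\not\equiv 2\pmod 7$. (3) For $p=p(a,b)$ prime, a correct (valid) witness choice is determined by the residue class of $(a,b)$ as follows: $w_2=5$ if $a-b\equiv 1$ or $2\pmod 4$, and $w_2$ is the least quadratic non-residue modulo $p$ otherwise; $w_3=7$ if $m\not\equiv2\pmod 7$, and $w_3$ is the least cubic non-residue modulo $p$ if $m\equiv 2\pmod 7$. (4) For $p=p(a,b)$ prime, in the case $m\equiv2\pmod7$ a cubic non-residue modulo $p$ is found deterministically by testing small primes: cubic non-residues form two-thirds of $(\mathbb{Z}/p\mathbb{Z})^{*}$, so one is reached after a bounded search. (5) Hence the certificate search is provably correct, rather than reliant on fixed witnesses succeeding by chance.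
   Context: For every $a,b\ge1$ one has $p\equiv1\pmod 6$ and $p-1=Fm$ with $F=2^{a}3^{b+1}>\sqrt p$, so the only primes dividing $F$ are $2$ and $3$. For $q\in\{2,3\}$, an integer $w$ is a valid Pocklington witness for $p$ at $q$ if $w^{p-1}\equiv 1\pmod p$ and $\gcd(w^{(p-1)/q}-1,\,p)=1$. A pair $(w_2,w_3)$ is a valid pair of Pocklington witnesses for $p$ if $w_2$ is valid at $q=2$ and $w_3$ is valid at $q=3$; by the Pocklington–Lehmer criterion, $p$ is prime if and only if such a pair exists, and the pair is then a primality certificate for $p$. The certificate search is the search for such a pair. For $p$ prime, a quadratic (resp. cubic) non-residue modulo $p$ is an integer coprime to $p$ that is not congruent to a square (resp. cube) modulo $p$; "least" means least positive integer with this property. *)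

theory Defs
  imports "HOL-Number_Theory.Number_Theory"
begin

definition cert_m :: "nat \<Rightarrow> nat \<Rightarrow> nat" where
  "cert_m a b = 2 ^ a * 3 ^ b - 1"

definition cert_p :: "nat \<Rightarrow> nat \<Rightarrow> nat" where
  "cert_p a b = 3 * cert_m a b * (cert_m a b + 1) + 1"

definition valid_witness :: "nat \<Rightarrow> nat \<Rightarrow> int \<Rightarrow> bool" where
  "valid_witness p q w \<longleftrightarrow>
     [w ^ (p - 1) = 1] (mod int p) \<and> gcd (w ^ ((p - 1) div q) - 1) (int p) = 1"

definition valid_pair :: "nat \<Rightarrow> int \<Rightarrow> int \<Rightarrow> bool" where
  "valid_pair p w2 w3 \<longleftrightarrow> valid_witness p 2 w2 \<and> valid_witness p 3 w3"

definition quadratic_nonresidue :: "nat \<Rightarrow> int \<Rightarrow> bool" where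
  "quadratic_nonresidue p w \<longleftrightarrow> coprime w (int p) \<and> \<not> QuadRes (int p) w"

definition cubic_nonresidue :: "nat \<Rightarrow> int \<Rightarrow> bool" where
  "cubic_nonresidue p w \<longleftrightarrow> coprime w (int p) \<and> \<not> (\<exists>y. [y ^ 3 = w] (mod int p))"

definition least_quadratic_nonresidue :: "nat \<Rightarrow> nat" where
  "least_quadratic_nonresidue p = (LEAST n. 0 < n \<and> quadratic_nonresidue p (int n))"

definition least_cubic_nonresidue :: "nat \<Rightarrow> nat" where
  "least_cubic_nonresidue p = (LEAST n. 0 < n \<and> cubic_nonresidue p (int n))"

definition five_case :: "nat \<Rightarrow> nat \<Rightarrow> bool" where
  "five_case a b \<longleftrightarrow> [int a - int b = 1] (mod 4) \<or> [int a - int b = 2] (mod 4)"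

definition seven_case :: "nat \<Rightarrow> nat \<Rightarrow> bool" where
  "seven_case a b \<longleftrightarrow> \<not> [cert_m a b = 2] (mod 7)"

definition choice2 :: "nat \<Rightarrow> nat \<Rightarrow> int" where
  "choice2 a b =
     (if five_case a b then 5 else int (least_quadratic_nonresidue (cert_p a b)))"

definition choice3 :: "nat \<Rightarrow> nat \<Rightarrow> int" where
  "choice3 a b =
     (if seven_case a b then 7 else int (least_cubic_nonresidue (cert_p a b)))"

text \<open>
  The search only uses the computable Pocklington test. For prime \<open>p\<close> with \<open>q dvd p - 1\<close>, there
  are \<open>(p - 1) div q\<close> nonzero \<open>q\<close>-th power residues, so some positive integer up to
  \<open>(p - 1) div q + 1\<close> is a non-residue; the least one is prime, because the residues are closed
  under multiplication. Hence the primes up to this bound, in increasing order, are the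
  candidates.
\<close>

definition prime_candidates :: "nat \<Rightarrow> nat \<Rightarrow> int list" where
  "prime_candidates p q = map int (filter prime [2..<(p - 1) div q + 2])"

definition prime_search :: "nat \<Rightarrow> nat \<Rightarrow> int option" where
  "prime_search p q = find (valid_witness p q) (prime_candidates p q)"

definition search2 :: "nat \<Rightarrow> nat \<Rightarrow> int option" where
  "search2 a b =
     (if five_case a b then find (valid_witness (cert_p a b) 2) [5]
      else prime_search (cert_p a b) 2)"

definition search3 :: "nat \<Rightarrow> nat \<Rightarrow> int option" where
  "search3 a b =
     (if seven_case a b then find (valid_witness (cert_p a b) 3) [7]
      else prime_search (cert_p a b) 3)"

text \<open>The value \<open>None\<close> reports that no certificate exists. Primality of the input is not assumed.\<close>

definition cert_search :: "nat \<Rightarrow> nat \<Rightarrow> (int \<times> int) option" where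
  "cert_search a b =
     (case (search2 a b, search3 a b) of
        (Some w2, Some w3) \<Rightarrow> Some (w2, w3)
      | _ \<Rightarrow> None)"

end

theory Submission
  imports "HOL-Algebra.Algebraic_Closure_Type" "Berlekamp_Zassenhaus.Finite_Field" Defs
begin

text \<open>
  Everything rests on Euler's criterion: for a prime \<open>p\<close> and \<open>q dvd p - 1\<close>, the integer \<open>w\<close> passes
  the Pocklington test at \<open>q\<close> if and only if \<open>w\<close> is not a \<open>q\<close>-th power modulo \<open>p\<close>
  (\<open>valid_witness_iff_power_nonresidue\<close>). So the validity of the pair \<open>(5, 7)\<close> asks when 5 is a square
  and when 7 is a cube modulo \<open>p = 3 m (m + 1) + 1\<close>, where \<open>m + 1 = 2\<^sup>a 3\<^sup>b\<close>.

  For 5 this is quadratic reciprocity: only \<open>p mod 5\<close> matters, and since \<open>2 * 3 = 1\<close> modulo 5 the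
  number \<open>m + 1\<close> is \<open>2\<^bsup>a - b\<^esup>\<close> there.

  For 7 it is an instance of cubic reciprocity, proved here with Gauss sums. Let \<open>\<chi>\<close> be a cubic
  character modulo \<open>p\<close> with Jacobi sum \<open>J = A + B \<omega>\<close>; counting gives integers \<open>A, B\<close> that serve for
  every field containing a primitive cube root of unity \<open>\<omega>\<close>. Over the complex numbers
  \<open>p = A\<^sup>2 - A B + B\<^sup>2\<close>, and a symmetry of order three shows that 3 divides \<open>B\<close>
  (\<open>jacobi_integer_form\<close>). Hence \<open>4 p = (2 A - B)\<^sup>2 + 27 (B / 3)\<^sup>2\<close>. Such a representation is unique up to
  signs (\<open>representation_27_unique\<close>), and \<open>4 p = (3 m + 1)\<^sup>2 + 27 ((m + 1) / 3)\<^sup>2\<close> is one, so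
  \<open>2 A - B\<close> and \<open>B / 3\<close> are known up to signs. In characteristic 7 the Gauss sum \<open>g\<close> satisfies both \<open>g\<^sup>3 = p J\<close> and, by the
  Frobenius map, \<open>\<chi>(7) g\<^sup>7 = g\<close>; eliminating \<open>g\<close> gives \<open>\<chi>(7) (p J)\<^sup>2 = 1\<close>. Because 7 is 1 modulo 3,
  \<open>\<omega>\<close> may be taken to be 2, and a finite computation modulo 7 shows that 7 is a cube modulo \<open>p\<close> if and
  only if 7 divides \<open>3 m + 1\<close> or \<open>(m + 1) / 3\<close> (\<open>seven_cubic_residue_iff\<close>). The second case never
  happens, as \<open>m + 1\<close> has only the prime factors 2 and 3; the first one says that \<open>m\<close> is 2 modulo 7.

  The pair \<open>(5, 7)\<close> therefore fails at \<open>p(1, 2) = 919\<close>, because \<open>a - b = - 1\<close>.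

  The search is correct because the least non-residue is prime and at most \<open>(p - 1) div q + 1\<close>: there
  are only \<open>(p - 1) div q\<close> residues, and residues are closed under products
  (\<open>least_power_nonresidue\<close>). So the first prime that passes the test is the least non-residue.
  Conversely, a valid pair proves primality even though its two members differ: the witness at 2 forces
  every prime divisor of \<open>p\<close> to be 1 modulo \<open>2\<^sup>a\<close>, the witness at 3 forces it to be 1 modulo
  \<open>3\<^bsup>b + 1\<^esup>\<close>, and together this makes it larger than the square root of \<open>p\<close>
  (\<open>prime_of_valid_pair\<close>).
\<close>

section \<open>Power residues modulo a prime\<close>

lemma coprime_prime_iff_int:
  assumes "prime p"
  shows "coprime w (int p) \<longleftrightarrow> \<not> int p dvd w"
  using assms by (metis coprime_absorb_right coprime_commute not_prime_unit prime_imp_coprime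
      prime_nat_int_transfer)

lemma fermat_theorem_int:
  assumes p: "prime p" and w: "\<not> int p dvd w"
  shows "[w ^ (p - 1) = 1] (mod int p)"
proof -
  have pos: "int p > 0"
    using p prime_gt_0_nat by simp
  have a: "int (nat (w mod int p)) = w mod int p"
    using pos by simp
  have "\<not> p dvd nat (w mod int p)"
    using w a by (metis dvd_mod_iff dvd_refl int_dvd_int_iff)
  then have "[nat (w mod int p) ^ (p - 1) = 1] (mod p)"
    by (rule fermat_theorem[OF p])
  then have "[(w mod int p) ^ (p - 1) = 1] (mod int p)"
    using a by (metis cong_int_iff of_nat_1 of_nat_power)
  then show ?thesis
    by (simp add: cong_def power_mod)
qed

text \<open>The logarithm is required to depend on residue classes only, and its value at multiples of
  \<open>p\<close> is left unspecified.\<close>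
definition is_discrete_log :: "nat \<Rightarrow> int \<Rightarrow> (int \<Rightarrow> nat) \<Rightarrow> bool" where
  "is_discrete_log p g dlog \<longleftrightarrow>
     (\<forall>x. \<not> int p dvd x \<longrightarrow> [g ^ dlog x = x] (mod int p)) \<and>
     (\<forall>i j. [g ^ i = g ^ j] (mod int p) \<longleftrightarrow> [i = j] (mod (p - 1))) \<and>
     (\<forall>x y. [x = y] (mod int p) \<longrightarrow> dlog x = dlog y)"

lemma is_discrete_logD:
  assumes "is_discrete_log p g dlog"
  shows "\<not> int p dvd x \<Longrightarrow> [g ^ dlog x = x] (mod int p)"
    and "[g ^ i = g ^ j] (mod int p) \<longleftrightarrow> [i = j] (mod (p - 1))"
    and "[x = y] (mod int p) \<Longrightarrow> dlog x = dlog y"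
  using assms unfolding is_discrete_log_def by blast+

lemma discrete_log_exists:
  fixes p :: nat
  assumes "prime p"
  shows "\<exists>g dlog. is_discrete_log p g dlog"
proof -
  obtain a where a: "a \<in> totatives p" "ord p a = p - 1"
    using residue_prime_has_primroot[OF assms] by blast
  have cop: "coprime p a"
    using a by (simp add: totatives_def coprime_commute)
  have cong_iff: "[int a ^ i = int a ^ j] (mod int p) \<longleftrightarrow> [i = j] (mod (p - 1))" for i j
    using order_divides_expdiff[OF cop, of i j] a(2)
    by (metis cong_int_iff of_nat_power)
  have "p \<ge> 2"
    using assms prime_ge_2_nat by blast
  let ?f = "\<lambda>i. int a ^ i mod int p"
  have inj: "inj_on ?f {..<p - 1}"
  proof (rule inj_onI)
    fix i j assume ij: "i \<in> {..<p - 1}" "j \<in> {..<p - 1}" "?f i = ?f j"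
    then have "[i = j] (mod (p - 1))"
      using cong_iff[of i j] by (simp add: cong_def)
    with ij show "i = j"
      by (simp add: cong_def)
  qed
  have sub: "?f ` {..<p - 1} \<subseteq> {1..int p - 1}"
  proof
    fix x assume "x \<in> ?f ` {..<p - 1}"
    then obtain i where i: "x = ?f i" by blast
    have "coprime (int a ^ i) (int p)"
      using cop by (simp add: coprime_commute)
    then have "x \<noteq> 0"
      using i coprime_prime_iff_int[OF assms] by (simp add: dvd_eq_mod_eq_0)
    moreover have "x \<ge> 0" "x < int p"
      using i \<open>p \<ge> 2\<close> by auto
    ultimately show "x \<in> {1..int p - 1}" by auto
  qed
  have "card (?f ` {..<p - 1}) = card {1..int p - 1}"
    using inj \<open>p \<ge> 2\<close> by (simp add: card_image nat_diff_distrib)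
  then have img: "?f ` {..<p - 1} = {1..int p - 1}"
    using sub by (intro card_subset_eq) auto
  have ex: "\<exists>k. [int a ^ k = x] (mod int p)" if "\<not> int p dvd x" for x
  proof -
    have "x mod int p \<noteq> 0" "0 \<le> x mod int p" "x mod int p < int p"
      using that \<open>p \<ge> 2\<close> by (simp_all add: dvd_eq_mod_eq_0)
    then have "x mod int p \<in> {1..int p - 1}"
      by simp
    then obtain i where "x mod int p = ?f i"
      using img by blast
    then show ?thesis
      by (metis cong_def)
  qed
  have "is_discrete_log p (int a) (\<lambda>x. SOME k. [int a ^ k = x] (mod int p))"
    unfolding is_discrete_log_def
  proof (intro conjI allI impI)
    show "[int a ^ (SOME k. [int a ^ k = x] (mod int p)) = x] (mod int p)"
      if "\<not> int p dvd x" for x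
      by (rule someI_ex[OF ex[OF that]])
    show "[int a ^ i = int a ^ j] (mod int p) \<longleftrightarrow> [i = j] (mod (p - 1))" for i j
      by (rule cong_iff)
    show "(SOME k. [int a ^ k = x] (mod int p)) = (SOME k. [int a ^ k = y] (mod int p))"
      if "[x = y] (mod int p)" for x y
      using that by (simp add: cong_def)
  qed
  then show ?thesis by blast
qed

lemma power_eq_one_iff_dvd_dlog:
  assumes "prime p" "q dvd p - 1" and dlog: "is_discrete_log p g dlog" and "\<not> int p dvd x"
  shows "[x ^ ((p - 1) div q) = 1] (mod int p) \<longleftrightarrow> q dvd dlog x"
proof -
  let ?i = "dlog x"
  note log = is_discrete_logD(1)[OF dlog \<open>\<not> int p dvd x\<close>]
  note inj = is_discrete_logD(2)[OF dlog]
  obtain r where r: "p - 1 = q * r"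
    using assms(2) by blast
  have "p - 1 > 0"
    using assms(1) prime_gt_1_nat by auto
  then have pos: "q > 0" "r > 0"
    using r by (metis mult_0 mult_0_right neq0_conv)+
  have "[(g ^ ?i) ^ r = x ^ r] (mod int p)"
    using log by (rule cong_pow)
  then have "[x ^ r = 1] (mod int p) \<longleftrightarrow> [g ^ (?i * r) = g ^ 0] (mod int p)"
    by (simp add: power_mult) (meson cong_sym cong_trans)
  also have "\<dots> \<longleftrightarrow> q * r dvd ?i * r"
    by (simp only: inj cong_0_iff r)
  also have "\<dots> \<longleftrightarrow> q dvd ?i"
    using pos by simp
  finally show ?thesis
    using r pos by simp
qed

text \<open>The residue symbol \<open>w\<^bsup>(p - 1) div q\<^esup>\<close> detects \<open>q\<close>-th powers because \<open>w\<close> is a power of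
  a primitive root, and being a \<open>q\<close>-th power means that \<open>q\<close> divides the exponent.\<close>
lemma power_residue_iff:
  assumes p: "prime p" and q: "q dvd p - 1" and w: "coprime w (int p)"
  shows "(\<exists>y. [y ^ q = w] (mod int p)) \<longleftrightarrow> [w ^ ((p - 1) div q) = 1] (mod int p)"
proof
  assume "\<exists>y. [y ^ q = w] (mod int p)"
  then obtain y where y: "[y ^ q = w] (mod int p)" by blast
  have "\<not> int p dvd w"
    using w coprime_prime_iff_int[OF p] by blast
  have "p - 1 > 0"
    using p prime_gt_1_nat by auto
  then have "q > 0" using q by (auto intro: Nat.gr0I)
  have "\<not> int p dvd y"
    using y \<open>\<not> int p dvd w\<close> \<open>q > 0\<close> by (metis cong_dvd_iff dvd_power dvd_trans)
  then have "[y ^ (p - 1) = 1] (mod int p)"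
    using fermat_theorem_int[OF p] by blast
  then have "[(y ^ q) ^ ((p - 1) div q) = 1] (mod int p)"
    using q by (simp flip: power_mult)
  then show "[w ^ ((p - 1) div q) = 1] (mod int p)"
    using cong_pow[OF y] by (meson cong_sym cong_trans)
next
  assume one: "[w ^ ((p - 1) div q) = 1] (mod int p)"
  obtain g dlog where dlog: "is_discrete_log p g dlog"
    using discrete_log_exists[OF p] by blast
  note log = is_discrete_logD(1)[OF dlog] and inj = is_discrete_logD(2)[OF dlog]
  have "\<not> int p dvd w"
    using w coprime_prime_iff_int[OF p] by blast
  from power_eq_one_iff_dvd_dlog[OF p q dlog this] one
  have "q dvd dlog w" by simp
  then have "[(g ^ (dlog w div q)) ^ q = w] (mod int p)"
    using log[OF \<open>\<not> int p dvd w\<close>] by (simp flip: power_mult)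
  then show "\<exists>y. [y ^ q = w] (mod int p)" by blast
qed

definition power_nonresidue :: "nat \<Rightarrow> nat \<Rightarrow> int \<Rightarrow> bool" where
  "power_nonresidue p q w \<longleftrightarrow> coprime w (int p) \<and> \<not> (\<exists>y. [y ^ q = w] (mod int p))"

lemma quadratic_nonresidue_eq: "quadratic_nonresidue p = power_nonresidue p 2"
  by (auto simp: fun_eq_iff quadratic_nonresidue_def power_nonresidue_def QuadRes_def)

lemma cubic_nonresidue_eq: "cubic_nonresidue p = power_nonresidue p 3"
  by (auto simp: fun_eq_iff cubic_nonresidue_def power_nonresidue_def)

lemma valid_witness_iff_power_nonresidue:
  assumes p: "prime p" and q: "q dvd p - 1"
  shows "valid_witness p q w \<longleftrightarrow> power_nonresidue p q w"
proof (cases "coprime w (int p)")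
  case True
  then have "\<not> int p dvd w"
    using coprime_prime_iff_int[OF p] by blast
  then have fermat: "[w ^ (p - 1) = 1] (mod int p)"
    using fermat_theorem_int[OF p] by blast
  have "gcd (w ^ ((p - 1) div q) - 1) (int p) = 1
      \<longleftrightarrow> \<not> [w ^ ((p - 1) div q) = 1] (mod int p)"
    using coprime_prime_iff_int[OF p] by (simp add: cong_iff_dvd_diff coprime_iff_gcd_eq_1)
  then show ?thesis
    using True fermat power_residue_iff[OF p q True]
    by (simp add: valid_witness_def power_nonresidue_def)
next
  case False
  then have "int p dvd w"
    using coprime_prime_iff_int[OF p] by blast
  moreover have "p - 1 > 0"
    using p prime_gt_1_nat by auto
  ultimately have "int p dvd w ^ (p - 1)"
    by (metis dvd_power dvd_trans)
  then have "\<not> [w ^ (p - 1) = 1] (mod int p)"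
    using p by (metis cong_dvd_iff not_prime_unit prime_nat_int_transfer)
  then show ?thesis
    using False by (simp add: valid_witness_def power_nonresidue_def)
qed

text \<open>The \<open>q\<close>-th powers are the powers of a primitive root whose exponents are multiples of \<open>q\<close>; below
  \<open>p - 1\<close> there are \<open>(p - 1) div q\<close> such exponents.\<close>
lemma card_power_residues:
  assumes p: "prime p" and q: "q dvd p - 1"
  shows "card {x \<in> {1..int p - 1}. \<exists>y. [y ^ q = x] (mod int p)} = (p - 1) div q"
proof -
  obtain g dlog where dlog: "is_discrete_log p g dlog"
    using discrete_log_exists[OF p] by blast
  note log = is_discrete_logD(1)[OF dlog] and inj = is_discrete_logD(2)[OF dlog]
  obtain r where r: "p - 1 = q * r"
    using q by blast
  have "p > 1"
    using p prime_gt_1_nat by auto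
  then have pos: "q > 0" "r > 0"
    using r \<open>p > 1\<close> by (metis mult_0 mult_0_right neq0_conv zero_less_diff)+
  have unit: "\<not> int p dvd x" if "x \<in> {1..int p - 1}" for x
    using that zdvd_imp_le[of "int p" x] by auto
  have "[g ^ (p - 1) = g ^ 0] (mod int p)"
    by (simp only: inj) (simp add: cong_def)
  then have "\<not> int p dvd g ^ (p - 1)"
    using p by (metis cong_dvd_iff not_prime_unit power_0 prime_nat_int_transfer)
  then have "\<not> int p dvd g"
    using \<open>p > 1\<close> by (metis dvd_power dvd_trans zero_less_diff)
  then have g_unit: "\<not> int p dvd g ^ i" for i
    using p by (metis prime_dvd_power prime_nat_int_transfer)
  let ?f = "\<lambda>i. g ^ (q * i) mod int p"
  have "{x \<in> {1..int p - 1}. \<exists>y. [y ^ q = x] (mod int p)} = ?f ` {..<r}"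
  proof (intro equalityI subsetI)
    fix x assume x: "x \<in> {x \<in> {1..int p - 1}. \<exists>y. [y ^ q = x] (mod int p)}"
    then have x1: "\<not> int p dvd x"
      using unit by blast
    then have "q dvd dlog x"
      using x power_residue_iff[OF p q, of x] power_eq_one_iff_dvd_dlog[OF p q dlog x1]
      by (simp add: coprime_prime_iff_int[OF p])
    then obtain i where i: "dlog x = q * i" by blast
    have "[q * (i mod r) = dlog x] (mod (p - 1))"
      unfolding cong_def i r by (metis mod_mod_trivial mult_mod_right)
    then have "[g ^ (q * (i mod r)) = x] (mod int p)"
      using inj log[OF x1] by (meson cong_trans)
    then have "?f (i mod r) = x"
      using x by (simp add: cong_def)
    then show "x \<in> ?f ` {..<r}"
      using pos by (metis imageI lessThan_iff mod_less_divisor)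
  next
    fix x assume "x \<in> ?f ` {..<r}"
    then obtain i where i: "x = ?f i" by blast
    have "[(g ^ i) ^ q = x] (mod int p)"
      by (simp add: i cong_def mult.commute flip: power_mult)
    moreover have "x \<noteq> 0"
      using g_unit[of "q * i"] by (simp add: i dvd_eq_mod_eq_0)
    moreover have "0 \<le> x" "x < int p"
      using \<open>p > 1\<close> by (simp_all add: i)
    ultimately show "x \<in> {x \<in> {1..int p - 1}. \<exists>y. [y ^ q = x] (mod int p)}"
      by auto
  qed
  moreover have "inj_on ?f {..<r}"
  proof (rule inj_onI)
    fix i j assume ij: "i \<in> {..<r}" "j \<in> {..<r}" "?f i = ?f j"
    then have "[q * i = q * j] (mod (q * r))"
      using inj[of "q * i" "q * j"] r by (simp add: cong_def)
    then have "q * i = q * j"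
      using ij pos by (simp add: cong_def)
    with pos show "i = j" by simp
  qed
  ultimately show ?thesis
    using r pos by (simp add: card_image)
qed

section \<open>The least non-residue and the search for it\<close>

definition least_power_nonresidue :: "nat \<Rightarrow> nat \<Rightarrow> nat" where
  "least_power_nonresidue p q = (LEAST n. 0 < n \<and> power_nonresidue p q (int n))"

text \<open>One more candidate than there are residues cannot consist of residues only.\<close>
lemma power_nonresidue_exists:
  assumes p: "prime p" and q: "q dvd p - 1" "q > 1"
  shows "\<exists>n>0. n \<le> (p - 1) div q + 1 \<and> power_nonresidue p q (int n)"
proof (rule ccontr)
  assume none: "\<not> ?thesis"
  let ?k = "(p - 1) div q"
  have "p > 1"
    using p prime_gt_1_nat by auto
  have "?k < p - 1"
    using \<open>p > 1\<close> q by simp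
  have "{1..int ?k + 1} \<subseteq> {x \<in> {1..int p - 1}. \<exists>y. [y ^ q = x] (mod int p)}"
  proof
    fix x assume x: "x \<in> {1..int ?k + 1}"
    have x2: "x \<in> {1..int p - 1}"
      using x \<open>?k < p - 1\<close> by auto
    then have "coprime x (int p)"
      using p prime_imp_coprime[of "int p" x] zdvd_imp_le[of "int p" x]
      by (auto simp: coprime_commute)
    moreover have "\<not> power_nonresidue p q (int (nat x))"
    proof -
      have "nat x > 0" "nat x \<le> ?k + 1"
        using x by auto
      with none show ?thesis by blast
    qed
    ultimately show "x \<in> {x \<in> {1..int p - 1}. \<exists>y. [y ^ q = x] (mod int p)}"
      using x x2 by (auto simp: power_nonresidue_def)
  qed
  then have "card {1..int ?k + 1} \<le> card {x \<in> {1..int p - 1}. \<exists>y. [y ^ q = x] (mod int p)}"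
    by (rule card_mono[rotated]) (rule finite_subset[of _ "{1..int p - 1}"], auto)
  then have "card {1..int ?k + 1} \<le> ?k"
    by (simp only: card_power_residues[OF p q(1)])
  then show False
    by (simp add: nat_add_distrib)
qed

text \<open>A proper factorization of the least non-residue would have two residues as factors, and then
  the product would be a residue as well. This is why searching among primes loses nothing.\<close>
lemma least_power_nonresidue:
  assumes p: "prime p" and q: "q dvd p - 1" "q > 1"
  shows "power_nonresidue p q (int (least_power_nonresidue p q))"
    and "least_power_nonresidue p q \<le> (p - 1) div q + 1"
    and "prime (least_power_nonresidue p q)"
    and "\<And>n. 0 < n \<Longrightarrow> n < least_power_nonresidue p q \<Longrightarrow> \<not> power_nonresidue p q (int n)"
proof -
  let ?n = "least_power_nonresidue p q"
  let ?P = "\<lambda>n. 0 < n \<and> power_nonresidue p q (int n)"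
  obtain k where k: "?P k" "k \<le> (p - 1) div q + 1"
    using power_nonresidue_exists[OF assms] by blast
  have n: "?P ?n"
    unfolding least_power_nonresidue_def by (rule LeastI[of ?P, OF k(1)])
  then show nr: "power_nonresidue p q (int ?n)" by simp
  show "?n \<le> (p - 1) div q + 1"
    using Least_le[of ?P k] k by (simp add: least_power_nonresidue_def)
  show min: "\<not> power_nonresidue p q (int m)" if "0 < m" "m < ?n" for m
    using not_less_Least[of m ?P] that by (auto simp: least_power_nonresidue_def)
  have "?n \<noteq> 1"
    using nr unfolding power_nonresidue_def by (metis cong_refl of_nat_1 power_one)
  show "prime ?n"
  proof (rule ccontr)
    assume "\<not> prime ?n"
    then obtain d where d: "d dvd ?n" "d \<noteq> 1" "d \<noteq> ?n"
      using n \<open>?n \<noteq> 1\<close> by (auto simp: prime_nat_iff)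
    then obtain e where e: "?n = d * e" by blast
    have pos: "0 < d" "0 < e"
      using n e by (auto intro!: Nat.gr0I)
    have "d < ?n" "e < ?n"
      using d pos e n by auto
    moreover have "coprime (int d) (int p)" "coprime (int e) (int p)"
      using nr by (auto simp: power_nonresidue_def e)
    ultimately obtain y z where "[y ^ q = int d] (mod int p)" "[z ^ q = int e] (mod int p)"
      using min pos unfolding power_nonresidue_def by blast
    then have "[(y * z) ^ q = int ?n] (mod int p)"
      by (simp add: e power_mult_distrib cong_mult)
    with nr show False
      by (auto simp: power_nonresidue_def)
  qed
qed

lemma find_map_filter_upt:
  assumes "a \<le> n" "n < b" "Q n" "P (f n)" "\<And>k. a \<le> k \<Longrightarrow> k < n \<Longrightarrow> \<not> P (f k)"
  shows "find P (map f (filter Q [a..<b])) = Some (f n)"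
proof -
  have "[a..<b] = [a..<n] @ n # [Suc n..<b]"
    using assms(1,2) by (metis le_add_diff_inverse less_imp_le_nat upt_add_eq_append upt_conv_Cons)
  moreover have "find P (map f (filter Q [a..<n])) = None"
    using assms(5) by (auto simp: find_None_iff)
  moreover have "find P (xs @ ys) = (case find P xs of None \<Rightarrow> find P ys | Some x \<Rightarrow> Some x)"
    for xs ys by (induction xs) auto
  ultimately show ?thesis
    using assms(3,4) by simp
qed

lemma prime_search_eq_least_power_nonresidue:
  assumes p: "prime p" and q: "q dvd p - 1" "q > 1"
  shows "prime_search p q = Some (int (least_power_nonresidue p q))"
  unfolding prime_search_def prime_candidates_def
proof (rule find_map_filter_upt)
  note n = least_power_nonresidue[OF assms]
  show "2 \<le> least_power_nonresidue p q"
    using n(3) prime_ge_2_nat by blast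
  show "least_power_nonresidue p q < (p - 1) div q + 2"
    using n(2) by simp
  show "prime (least_power_nonresidue p q)"
    by (rule n(3))
  show "valid_witness p q (int (least_power_nonresidue p q))"
    using n(1) valid_witness_iff_power_nonresidue[OF p q(1)] by simp
  show "\<not> valid_witness p q (int k)" if "2 \<le> k" "k < least_power_nonresidue p q" for k
    using n(4)[of k] that valid_witness_iff_power_nonresidue[OF p q(1)] by simp
qed

section \<open>The Pocklington criterion with one witness for each prime\<close>

text \<open>Pocklington's lemma, applied to the prime power \<open>q ^ k\<close> alone: if \<open>r\<close> is a prime divisor of \<open>p\<close>,
  then \<open>w ^ s\<close> has order exactly \<open>q ^ k\<close> modulo \<open>r\<close>.\<close>
lemma prime_divisor_cong_one_of_valid_witness:
  assumes q: "prime q" and pq: "p - 1 = q ^ k * s" and p: "p \<ge> 2"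
    and w: "valid_witness p q w" and r: "prime r" "r dvd p"
  shows "[r = 1] (mod q ^ k)"
proof -
  let ?a = "nat (w mod int p)"
  have a: "int ?a = w mod int p"
    using p by simp
  have cong: "[int ?a ^ i = w ^ i] (mod int p)" for i
    unfolding a by (intro cong_pow) (simp add: cong_def)
  have one: "[int ?a ^ (p - 1) = 1] (mod int p)"
    using w cong[of "p - 1"] unfolding valid_witness_def by (meson cong_trans)
  show ?thesis
  proof (rule pocklington_lemma[OF p pq _ _ r])
    show "[?a ^ (p - 1) = 1] (mod p)"
      using one by (metis cong_int_iff of_nat_1 of_nat_power)
    have "?a \<noteq> 0"
    proof
      assume "?a = 0"
      then have "[0 = 1] (mod int p)"
        using one p by (simp add: power_0_left)
      then show False using p by (simp add: cong_def)
    qed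
    show "\<forall>l. prime l \<and> l dvd q ^ k \<longrightarrow> coprime (?a ^ ((p - 1) div l) - 1) p"
    proof (intro allI impI)
      fix l assume l: "prime l \<and> l dvd q ^ k"
      then have "l = q"
        using q by (metis prime_dvd_power primes_dvd_imp_eq)
      have "[int ?a ^ ((p - 1) div q) - 1 = w ^ ((p - 1) div q) - 1] (mod int p)"
        by (intro cong_diff cong cong_refl)
      then have "coprime (int ?a ^ ((p - 1) div q) - 1) (int p)"
        using w unfolding valid_witness_def
        by (metis cong_imp_coprime cong_sym coprime_iff_gcd_eq_1)
      moreover have "int ?a ^ ((p - 1) div q) - 1 = int (?a ^ ((p - 1) div q) - 1)"
        using \<open>?a \<noteq> 0\<close> by (simp add: of_nat_diff)
      ultimately show "coprime (?a ^ ((p - 1) div l) - 1) p"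
        using \<open>l = q\<close> by (metis coprime_int_iff)
    qed
  qed
qed

text \<open>The congruences contributed by the two witnesses combine by the Chinese remainder theorem, so
  a prime divisor of \<open>p\<close> exceeds \<open>2 ^ i * 3 ^ j\<close>, and this exceeds the square root of \<open>p\<close>.\<close>
lemma prime_of_valid_pair:
  assumes F: "p - 1 = 2 ^ i * 3 ^ j * s" "p < (2 ^ i * 3 ^ j)\<^sup>2" and p: "p \<ge> 2"
    and w: "valid_pair p w2 w3"
  shows "prime p"
proof (rule prime_prime_factor_sqrt[THEN iffD2], intro conjI notI)
  assume "\<exists>r. prime r \<and> r dvd p \<and> r\<^sup>2 \<le> p"
  then obtain r where r: "prime r" "r dvd p" "r\<^sup>2 \<le> p" by blast
  have w2: "valid_witness p 2 w2" and w3: "valid_witness p 3 w3"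
    using w by (simp_all add: valid_pair_def)
  have "[r = 1] (mod 2 ^ i)"
    by (rule prime_divisor_cong_one_of_valid_witness[OF _ _ p w2 r(1,2), where s = "3 ^ j * s"])
      (use F(1) in \<open>simp_all add: mult_ac\<close>)
  moreover have "[r = 1] (mod 3 ^ j)"
    by (rule prime_divisor_cong_one_of_valid_witness[OF _ _ p w3 r(1,2), where s = "2 ^ i * s"])
      (use F(1) in \<open>simp_all add: mult_ac\<close>)
  moreover have "coprime (2 ^ i) (3 ^ j :: nat)"
    using primes_coprime_nat[of 2 3] by simp
  ultimately have "[r = 1] (mod 2 ^ i * 3 ^ j)"
    using coprime_cong_mult_nat by blast
  then have "2 ^ i * 3 ^ j dvd r - 1"
    by (rule cong_to_1_nat)
  moreover have "r - 1 > 0"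
    using r prime_gt_1_nat by auto
  ultimately have "2 ^ i * 3 ^ j \<le> r - 1"
    by (rule dvd_imp_le)
  then have "(2 ^ i * 3 ^ j)\<^sup>2 \<le> r\<^sup>2"
    by (intro power_mono) auto
  with r(3) F(2) show False by linarith
qed (use p in auto)

section \<open>Roots of unity\<close>

lemma sum_residues_reindex:
  fixes f :: "int \<Rightarrow> 'a::comm_monoid_add" and n :: int
  assumes n: "n > 0" and f: "\<And>x y. [x = y] (mod n) \<Longrightarrow> f x = f y"
    and h: "\<And>x y. [h x = h y] (mod n) \<Longrightarrow> [x = y] (mod n)"
  shows "(\<Sum>x\<in>{0..<n}. f (h x)) = (\<Sum>x\<in>{0..<n}. f x)"
proof -
  have inj: "inj_on (\<lambda>x. h x mod n) {0..<n}"
  proof (rule inj_onI)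
    fix x y assume xy: "x \<in> {0..<n}" "y \<in> {0..<n}" "h x mod n = h y mod n"
    then have "[h x = h y] (mod n)"
      by (simp add: cong_def)
    then have "[x = y] (mod n)"
      by (rule h)
    with xy show "x = y"
      by (metis atLeastLessThan_iff cong_less_imp_eq_int)
  qed
  have "(\<lambda>x. h x mod n) ` {0..<n} \<subseteq> {0..<n}"
    using n by auto
  then have img: "(\<lambda>x. h x mod n) ` {0..<n} = {0..<n}"
    using inj by (intro endo_inj_surj) auto
  have "(\<Sum>x\<in>{0..<n}. f (h x)) = (\<Sum>x\<in>{0..<n}. f (h x mod n))"
    by (rule sum.cong[OF refl], rule f, rule cong_sym, rule cong_mod_leftI, rule cong_refl)
  also have "\<dots> = (\<Sum>x\<in>(\<lambda>x. h x mod n) ` {0..<n}. f x)"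
    by (simp only: sum.reindex[OF inj] o_def)
  finally show ?thesis
    by (simp only: img)
qed

text \<open>No element qualifies in characteristic 3, in which 1 is the only cube root of unity.\<close>
definition primitive_cube_root :: "'a::field \<Rightarrow> bool" where
  "primitive_cube_root \<omega> \<longleftrightarrow> \<omega> ^ 3 = 1 \<and> \<omega> \<noteq> 1"

lemma primitive_cube_root_sum:
  assumes "primitive_cube_root (\<omega>::'a::field)"
  shows "1 + \<omega> + \<omega>\<^sup>2 = 0"
proof -
  have "(\<omega> - 1) * (1 + \<omega> + \<omega>\<^sup>2) = \<omega> ^ 3 - 1"
    by (simp add: algebra_simps power2_eq_square power3_eq_cube)
  then show ?thesis
    using assms by (simp add: primitive_cube_root_def)
qed

lemma primitive_cube_root_power_eq:
  assumes "primitive_cube_root (\<omega>::'a::field)" and "[i = j] (mod 3)"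
  shows "\<omega> ^ i = \<omega> ^ j"
proof -
  have w3: "\<omega> ^ 3 = 1"
    using assms(1) by (simp add: primitive_cube_root_def)
  have red: "\<omega> ^ i = \<omega> ^ (i mod 3)" for i
  proof -
    have "\<omega> ^ i = \<omega> ^ (3 * (i div 3) + i mod 3)"
      by simp
    also have "\<dots> = \<omega> ^ (i mod 3)"
      by (simp only: power_add power_mult w3 power_one mult_1)
    finally show ?thesis .
  qed
  show ?thesis
    using assms(2) red[of i] red[of j] by (simp add: cong_def)
qed

lemma primitive_cube_root_power_eq_1_iff:
  assumes w: "primitive_cube_root (\<omega>::'a::field)"
  shows "\<omega> ^ i = 1 \<longleftrightarrow> 3 dvd i"
proof
  assume "3 dvd i"
  then show "\<omega> ^ i = 1"
    using primitive_cube_root_power_eq[OF w, of i 0] by (simp add: cong_0_iff)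
next
  assume one: "\<omega> ^ i = 1"
  have w1: "\<omega> \<noteq> 1" "\<omega> * \<omega>\<^sup>2 = 1"
    using w by (simp_all add: primitive_cube_root_def power3_eq_cube power2_eq_square mult.assoc)
  then have "\<omega>\<^sup>2 \<noteq> 1" by auto
  have "i mod 3 = 0 \<or> i mod 3 = 1 \<or> i mod 3 = 2" by auto
  moreover have "\<omega> ^ (i mod 3) = 1"
    using primitive_cube_root_power_eq[OF w, of "i mod 3" i] one by (simp add: cong_def)
  ultimately show "3 dvd i"
    using w1(1) \<open>\<omega>\<^sup>2 \<noteq> 1\<close> by auto
qed

lemma primitive_cube_root_power2:
  assumes w: "primitive_cube_root (\<omega>::'a::field)"
  shows "primitive_cube_root (\<omega>\<^sup>2)" "(\<omega>\<^sup>2)\<^sup>2 = \<omega>"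
proof -
  show "primitive_cube_root (\<omega>\<^sup>2)"
    using primitive_cube_root_power_eq_1_iff[OF w, of 2] primitive_cube_root_power_eq_1_iff[OF w, of 6]
    unfolding primitive_cube_root_def by (simp flip: power_mult)
  show "(\<omega>\<^sup>2)\<^sup>2 = \<omega>"
    using primitive_cube_root_power_eq[OF w, of 4 1] by (simp add: cong_def flip: power_mult)
qed

text \<open>A root of \<open>1 + x + \<dots> + x\<^bsup>n - 1\<^esup>\<close> is an \<open>n\<close>-th root of unity, and it is not 1 because the value of
  this polynomial at 1 is \<open>n\<close>. The lemma serves the complex numbers and the algebraic closure of a
  finite field alike.\<close>
lemma nontrivial_root_of_unity_exists:
  assumes "n > 1" and "of_nat n \<noteq> (0::'a::alg_closed_field)"
  shows "\<exists>\<zeta>::'a. \<zeta> ^ n = 1 \<and> \<zeta> \<noteq> 1"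
proof -
  obtain \<zeta> :: 'a where z: "(\<Sum>k\<le>n - 1. 1 * \<zeta> ^ k) = 0"
    using alg_closed[of "n - 1" "\<lambda>_. 1 :: 'a"] assms(1) by auto
  moreover have "{..n - 1} = {..<n}"
    using assms(1) by auto
  ultimately have "(\<Sum>k<n. \<zeta> ^ k) = 0"
    by simp
  then have "\<zeta> ^ n = 1"
    using power_diff_1_eq[of \<zeta> n] by simp
  moreover have "\<zeta> \<noteq> 1"
    using \<open>(\<Sum>k<n. \<zeta> ^ k) = 0\<close> assms(2) by auto
  ultimately show ?thesis by blast
qed

lemma power_int_eq_of_cong:
  fixes \<zeta> :: "'a::field"
  assumes "\<zeta> ^ n = 1" "\<zeta> \<noteq> 0" "[x = y] (mod int n)"
  shows "\<zeta> powi x = \<zeta> powi y"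
proof -
  obtain k where "x = y + int n * k"
    using assms(3) by (metis cong_iff_lin cong_sym)
  then show ?thesis
    using assms by (simp add: power_int_add power_int_mult)
qed

lemma sum_power_int_residues:
  fixes \<zeta> :: "'a::field"
  assumes p: "prime p" and z: "\<zeta> ^ p = 1" "\<zeta> \<noteq> 1"
  shows "(\<Sum>y\<in>{0..<int p}. \<zeta> powi (t * y)) = (if int p dvd t then of_nat p else 0)"
proof -
  have p0: "int p > 0"
    using p prime_gt_0_nat by simp
  have z0: "\<zeta> \<noteq> 0"
    using z(1) p0 by (metis not_gr0 of_nat_0_less_iff power_0_left zero_neq_one)
  note per = power_int_eq_of_cong[OF z(1) z0]
  show ?thesis
  proof (cases "int p dvd t")
    case True
    then have "\<zeta> powi (t * y) = 1" for y
      using per[of "t * y" 0] by (simp add: cong_0_iff)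
    with True show ?thesis by simp
  next
    case False
    have cop: "coprime t (int p)"
      using False p prime_imp_coprime[of "int p" t] by (simp add: coprime_commute)
    have "(\<Sum>y\<in>{0..<int p}. \<zeta> powi (t * y)) = (\<Sum>y\<in>{0..<int p}. \<zeta> powi y)"
      using p0 per cop by (intro sum_residues_reindex) (simp_all add: cong_mult_lcancel)
    moreover have "(\<Sum>y\<in>{0..<int p}. \<zeta> powi (y + 1)) = (\<Sum>y\<in>{0..<int p}. \<zeta> powi y)"
      using p0 per by (intro sum_residues_reindex) (simp_all add: cong_add_rcancel)
    then have "(\<zeta> - 1) * (\<Sum>y\<in>{0..<int p}. \<zeta> powi y) = 0"
      using z0 by (simp add: power_int_add algebra_simps flip: sum_distrib_left sum_distrib_right)
    ultimately show ?thesis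
      using False z(2) by simp
  qed
qed

section \<open>Gauss and Jacobi sums of a cubic character\<close>

text \<open>The data of a nontrivial cubic character modulo \<open>p\<close>, written additively: \<open>ind\<close> is a homomorphism
  from the units modulo \<open>p\<close> to the integers modulo 3. Fixing the exponent instead of the values lets the
  same character take its values in fields of different characteristic.\<close>
locale cubic_index =
  fixes p :: nat and ind :: "int \<Rightarrow> nat"
  assumes prime: "prime p"
    and ind_cong: "[x = y] (mod int p) \<Longrightarrow> ind x = ind y"
    and ind_mult: "\<not> int p dvd x \<Longrightarrow> \<not> int p dvd y \<Longrightarrow> [ind (x * y) = ind x + ind y] (mod 3)"
    and ind_nontrivial: "\<exists>x. \<not> int p dvd x \<and> \<not> 3 dvd ind x"
begin

definition chi :: "'a::field \<Rightarrow> int \<Rightarrow> 'a" where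
  "chi \<omega> x = (if int p dvd x then 0 else \<omega> ^ ind x)"

lemma p_pos: "int p > 0"
  using prime prime_gt_0_nat by simp

lemma p_dvd_mult_iff: "int p dvd x * y \<longleftrightarrow> int p dvd x \<or> int p dvd y"
  using prime by (simp add: prime_dvd_mult_iff)

lemma p_not_dvd_1: "\<not> int p dvd 1"
  using prime by (metis not_prime_unit prime_nat_int_transfer)

lemma p_not_dvd_residue: "x \<in> {0..<int p} \<Longrightarrow> x \<noteq> 0 \<Longrightarrow> \<not> int p dvd x"
  using zdvd_imp_le[of "int p" x] by auto

lemma coprime_p: "\<not> int p dvd x \<Longrightarrow> coprime x (int p)"
  using prime prime_imp_coprime[of "int p" x] by (simp add: coprime_commute)

lemma ind_1: "3 dvd ind 1"
proof -
  have "[ind 1 + 0 = ind 1 + ind 1] (mod 3)"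
    using ind_mult[of 1 1] p_not_dvd_1 by simp
  then show ?thesis
    by (simp only: cong_add_lcancel_nat cong_0_iff cong_sym_eq[of 0])
qed

lemma ind_minus_1: "3 dvd ind (- 1)"
proof -
  have "[ind 1 = 2 * ind (- 1)] (mod 3)"
    using ind_mult[of "-1" "-1"] p_not_dvd_1 by (simp add: mult_2)
  then have "3 dvd 2 * ind (- 1)"
    using ind_1 by (metis cong_dvd_iff cong_def dvd_eq_mod_eq_0)
  then show ?thesis by presburger
qed

lemma chi_cong: "[x = y] (mod int p) \<Longrightarrow> chi \<omega> x = chi \<omega> y"
  using cong_dvd_iff[of x y "int p"] by (simp add: chi_def ind_cong)

lemma chi_mult: "primitive_cube_root \<omega> \<Longrightarrow> chi \<omega> (x * y) = chi \<omega> x * chi \<omega> y"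
  using primitive_cube_root_power_eq[OF _ ind_mult]
  by (auto simp: chi_def p_dvd_mult_iff power_add)

lemma chi_minus_1: "primitive_cube_root \<omega> \<Longrightarrow> chi \<omega> (- 1) = 1"
  using primitive_cube_root_power_eq_1_iff[of \<omega> "ind (- 1)"] ind_minus_1 p_not_dvd_1
  by (simp add: chi_def)

lemma chi_power2: "chi (\<omega>\<^sup>2) x = chi \<omega> x * chi \<omega> x"
  by (simp add: chi_def mult_2 flip: power_mult power_add)

lemma chi_mult_chi_power2:
  "primitive_cube_root \<omega> \<Longrightarrow> \<not> int p dvd x \<Longrightarrow> chi \<omega> x * chi (\<omega>\<^sup>2) x = 1"
  using primitive_cube_root_power_eq_1_iff[of \<omega> "3 * ind x"]
  by (simp add: chi_def flip: power_mult power_add)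

lemma sum_chi:
  assumes w: "primitive_cube_root (\<omega>::'a::field)"
  shows "(\<Sum>x\<in>{0..<int p}. chi \<omega> x) = 0"
proof -
  obtain g where g: "\<not> int p dvd g" "\<not> 3 dvd ind g"
    using ind_nontrivial by blast
  then have "chi \<omega> g \<noteq> 1"
    using primitive_cube_root_power_eq_1_iff[OF w] by (simp add: chi_def)
  have "(\<Sum>x\<in>{0..<int p}. chi \<omega> (g * x)) = (\<Sum>x\<in>{0..<int p}. chi \<omega> x)"
    using p_pos chi_cong coprime_p[OF g(1)]
    by (intro sum_residues_reindex) (simp_all add: cong_mult_lcancel)
  then have "(chi \<omega> g - 1) * (\<Sum>x\<in>{0..<int p}. chi \<omega> x) = 0"
    by (simp add: chi_mult[OF w] left_diff_distrib flip: sum_distrib_left)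
  with \<open>chi \<omega> g \<noteq> 1\<close> show ?thesis by simp
qed

definition jacobi :: "'a::field \<Rightarrow> 'a" where
  "jacobi \<omega> = (\<Sum>x\<in>{0..<int p}. chi \<omega> x * chi \<omega> (1 - x))"

definition gauss :: "'a::field \<Rightarrow> 'a \<Rightarrow> 'a" where
  "gauss \<omega> \<zeta> = (\<Sum>x\<in>{0..<int p}. chi \<omega> x * \<zeta> powi x)"

text \<open>For a unit \<open>y\<close>, the substitution of \<open>y * x\<close> for \<open>x\<close> pulls the factor \<open>chi \<omega> y\<close> out twice. For
  \<open>y = 0\<close> both sides vanish, since the square of \<open>\<chi>\<close> is again a nontrivial character.\<close>
lemma sum_chi_convolution:
  assumes w: "primitive_cube_root (\<omega>::'a::field)" and y: "y \<in> {0..<int p}"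
  shows "(\<Sum>x\<in>{0..<int p}. chi \<omega> x * chi \<omega> (y - x)) = jacobi \<omega> * chi (\<omega>\<^sup>2) y"
proof (cases "y = 0")
  case True
  have "chi \<omega> x * chi \<omega> (y - x) = chi (\<omega>\<^sup>2) x" for x
    using chi_mult[OF w, of "- 1" x] chi_minus_1[OF w] True
    by (simp add: chi_power2)
  then have "(\<Sum>x\<in>{0..<int p}. chi \<omega> x * chi \<omega> (y - x)) = 0"
    using sum_chi[OF primitive_cube_root_power2(1)[OF w]] by simp
  then show ?thesis
    using True by (simp add: chi_def)
next
  case False
  have "\<not> int p dvd y"
    using p_not_dvd_residue[OF y False] .
  let ?f = "\<lambda>x. chi \<omega> x * chi \<omega> (y - x)"
  have "(\<Sum>x\<in>{0..<int p}. ?f x) = (\<Sum>x\<in>{0..<int p}. ?f (y * x))"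
  proof (rule sum_residues_reindex[symmetric, OF p_pos])
    show "?f x = ?f x'" if "[x = x'] (mod int p)" for x x'
      using chi_cong[OF that] chi_cong[OF cong_diff[OF cong_refl that]] by metis
    show "[x = x'] (mod int p)" if "[y * x = y * x'] (mod int p)" for x x'
      using that coprime_p[OF \<open>\<not> int p dvd y\<close>] by (simp add: cong_mult_lcancel)
  qed
  also have "\<dots> = (\<Sum>x\<in>{0..<int p}. chi (\<omega>\<^sup>2) y * (chi \<omega> x * chi \<omega> (1 - x)))"
  proof (rule sum.cong[OF refl])
    show "?f (y * x) = chi (\<omega>\<^sup>2) y * (chi \<omega> x * chi \<omega> (1 - x))" for x
      using chi_mult[OF w, of y x] chi_mult[OF w, of y "1 - x"]
      by (simp add: algebra_simps chi_power2)
  qed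
  finally show ?thesis
    by (simp add: jacobi_def mult.commute flip: sum_distrib_left)
qed

context
  fixes \<omega> \<zeta> :: "'a::field"
  assumes w: "primitive_cube_root \<omega>" and z: "\<zeta> ^ p = 1" "\<zeta> \<noteq> 1"
begin

lemma zeta_nonzero: "\<zeta> \<noteq> 0"
  using z(1) p_pos by (metis not_gr0 of_nat_0_less_iff power_0_left zero_neq_one)

lemmas powi_zeta_cong = power_int_eq_of_cong[OF z(1) zeta_nonzero]

text \<open>Sort the terms of the double sum by the exponent of \<open>\<zeta>\<close>.\<close>
lemma gauss_squared: "(gauss \<omega> \<zeta>)\<^sup>2 = jacobi \<omega> * gauss (\<omega>\<^sup>2) \<zeta>"
proof -
  let ?R = "{0..<int p}"
  have "(gauss \<omega> \<zeta>)\<^sup>2 = (\<Sum>x\<in>?R. \<Sum>y\<in>?R. chi \<omega> x * chi \<omega> y * \<zeta> powi (y + x))"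
    by (simp add: gauss_def power2_eq_square sum_product power_int_add zeta_nonzero mult_ac)
  also have "\<dots> = (\<Sum>x\<in>?R. \<Sum>y\<in>?R. chi \<omega> x * chi \<omega> (y - x) * \<zeta> powi y)"
  proof (rule sum.cong[OF refl])
    fix x
    let ?f = "\<lambda>y. chi \<omega> x * chi \<omega> (y - x) * \<zeta> powi y"
    have "(\<Sum>y\<in>?R. ?f (y + x)) = (\<Sum>y\<in>?R. ?f y)"
    proof (rule sum_residues_reindex[OF p_pos])
      show "?f y = ?f y'" if "[y = y'] (mod int p)" for y y'
        using powi_zeta_cong[OF that] chi_cong[OF cong_diff[OF that cong_refl]] by metis
    qed (simp add: cong_add_rcancel)
    then show "(\<Sum>y\<in>?R. chi \<omega> x * chi \<omega> y * \<zeta> powi (y + x)) = (\<Sum>y\<in>?R. ?f y)"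
      by simp
  qed
  also have "\<dots> = (\<Sum>y\<in>?R. (\<Sum>x\<in>?R. chi \<omega> x * chi \<omega> (y - x)) * \<zeta> powi y)"
    by (subst sum.swap) (simp add: sum_distrib_right)
  also have "\<dots> = jacobi \<omega> * gauss (\<omega>\<^sup>2) \<zeta>"
    by (simp add: sum_chi_convolution[OF w] gauss_def sum_distrib_left mult.assoc)
  finally show ?thesis .
qed

text \<open>Scale \<open>x\<close> by \<open>y\<close> in the double sum: the character values at \<open>y\<close> cancel, and the geometric sum over
  \<open>y\<close> isolates \<open>x = - 1\<close>.\<close>
lemma gauss_times_conjugate: "gauss \<omega> \<zeta> * gauss (\<omega>\<^sup>2) \<zeta> = of_nat p"
proof -
  let ?R = "{0..<int p}"
  have R0: "0 \<in> ?R"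
    using p_pos by simp
  have "gauss \<omega> \<zeta> * gauss (\<omega>\<^sup>2) \<zeta>
      = (\<Sum>y\<in>?R. \<Sum>x\<in>?R. chi \<omega> x * chi (\<omega>\<^sup>2) y * \<zeta> powi (x + y))"
    by (subst sum.swap)
      (simp add: gauss_def sum_product power_int_add zeta_nonzero mult_ac)
  also have "\<dots> = (\<Sum>y\<in>?R - {0}. \<Sum>x\<in>?R. chi \<omega> x * chi (\<omega>\<^sup>2) y * \<zeta> powi (x + y))"
    using R0 by (subst sum.remove[of _ 0]) (auto simp: chi_def)
  also have "\<dots> = (\<Sum>y\<in>?R - {0}. \<Sum>x\<in>?R. chi \<omega> x * \<zeta> powi ((x + 1) * y))"
  proof (rule sum.cong[OF refl])
    fix y assume y: "y \<in> ?R - {0}"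
    then have ny: "\<not> int p dvd y"
      using p_not_dvd_residue by blast
    let ?f = "\<lambda>x. chi \<omega> x * chi (\<omega>\<^sup>2) y * \<zeta> powi (x + y)"
    have "(\<Sum>x\<in>?R. ?f x) = (\<Sum>x\<in>?R. ?f (y * x))"
    proof (rule sum_residues_reindex[symmetric, OF p_pos])
      show "?f x = ?f x'" if "[x = x'] (mod int p)" for x x'
        using powi_zeta_cong[OF cong_add[OF that cong_refl]] chi_cong[OF that] by metis
      show "[x = x'] (mod int p)" if "[y * x = y * x'] (mod int p)" for x x'
        using that coprime_p[OF ny] by (simp add: cong_mult_lcancel)
    qed
    also have "\<dots> = (\<Sum>x\<in>?R. chi \<omega> x * \<zeta> powi ((x + 1) * y))"
    proof (rule sum.cong[OF refl])
      fix x
      have "?f (y * x) = (chi \<omega> y * chi (\<omega>\<^sup>2) y) * chi \<omega> x * \<zeta> powi (y * x + y)"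
        by (simp add: chi_mult[OF w])
      then show "?f (y * x) = chi \<omega> x * \<zeta> powi ((x + 1) * y)"
        by (simp add: chi_mult_chi_power2[OF w ny] algebra_simps)
    qed
    finally show "(\<Sum>x\<in>?R. ?f x) = (\<Sum>x\<in>?R. chi \<omega> x * \<zeta> powi ((x + 1) * y))" .
  qed
  also have "\<dots> = (\<Sum>x\<in>?R. chi \<omega> x * ((\<Sum>y\<in>?R. \<zeta> powi ((x + 1) * y)) - 1))"
    using R0 by (subst sum.swap) (simp add: sum_diff1 sum_distrib_left flip: sum_distrib_left)
  also have "\<dots> = (\<Sum>x\<in>?R. chi \<omega> x * (if int p dvd x + 1 then of_nat p else 0))"
    by (simp add: sum_power_int_residues[OF prime z] right_diff_distrib sum_subtractf sum_chi[OF w])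
  also have "\<dots> = (\<Sum>x\<in>?R. if x = int p - 1 then of_nat p else 0)"
  proof (rule sum.cong[OF refl])
    fix x assume x: "x \<in> ?R"
    have "chi \<omega> (int p - 1) = 1"
      using chi_cong[of "int p - 1" "- 1" \<omega>] chi_minus_1[OF w] by (simp add: cong_def)
    moreover have "int p dvd x + 1 \<longleftrightarrow> x = int p - 1"
      using x zdvd_imp_le[of "int p" "x + 1"] by auto
    ultimately show "chi \<omega> x * (if int p dvd x + 1 then of_nat p else 0)
        = (if x = int p - 1 then of_nat p else 0)"
      by simp
  qed
  also have "\<dots> = of_nat p"
    using p_pos by simp
  finally show ?thesis .
qed

lemma gauss_cubed: "gauss \<omega> \<zeta> ^ 3 = of_nat p * jacobi \<omega>"
proof -
  have "gauss \<omega> \<zeta> ^ 3 = (gauss \<omega> \<zeta>)\<^sup>2 * gauss \<omega> \<zeta>"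
    by (simp add: power3_eq_cube power2_eq_square)
  also have "\<dots> = jacobi \<omega> * (gauss \<omega> \<zeta> * gauss (\<omega>\<^sup>2) \<zeta>)"
    by (simp add: gauss_squared mult_ac)
  finally show ?thesis
    by (simp add: gauss_times_conjugate mult.commute)
qed

text \<open>The reciprocity step. In characteristic \<open>l\<close> the \<open>l\<close>-th power is additive and fixes the values of
  \<open>\<chi>\<close>, as \<open>l\<close> is 1 modulo 3; so it turns \<open>\<zeta>\<close> into \<open>\<zeta> ^ l\<close>, which scales the Gauss sum by the inverse
  of \<open>\<chi>(l)\<close>. The Gauss sum is then eliminated through its cube.\<close>
lemma chi_times_jacobi_power:
  assumes l: "prime l" "CHAR('a) = l" "l mod 3 = 1" "l \<noteq> p"
  shows "chi \<omega> (int l) * (of_nat p * jacobi \<omega>) ^ ((l - 1) div 3) = 1"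
proof -
  have pl: "\<not> int p dvd int l"
    using l(1,4) prime by (metis int_dvd_int_iff primes_dvd_imp_eq)
  have "\<not> l dvd p"
    using l(1,4) prime by (metis primes_dvd_imp_eq)
  then have "of_nat p \<noteq> (0::'a)"
    using l(2) of_nat_eq_0_iff_char_dvd[where 'a = 'a, of p] by simp
  then have g0: "gauss \<omega> \<zeta> \<noteq> 0"
    using gauss_times_conjugate by auto
  have chi_l: "chi \<omega> x ^ l = chi \<omega> x" for x
  proof -
    have "[ind x * l = ind x * 1] (mod 3)"
      using l(3) by (intro cong_mult cong_refl) (simp add: cong_def)
    then show ?thesis
      using primitive_cube_root_power_eq[OF w, of "ind x * l" "ind x"] prime_gt_0_nat[OF l(1)]
      by (simp add: chi_def flip: power_mult)
  qed
  have zeta_l: "(\<zeta> powi x) ^ l = \<zeta> powi (int l * x)" for x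
    by (metis mult.commute power_int_mult power_int_of_nat)
  have "gauss \<omega> \<zeta> ^ l = (\<Sum>x\<in>{0..<int p}. (chi \<omega> x * \<zeta> powi x) ^ l)"
    using l(1,2) unfolding gauss_def by (intro freshmans_dream_sum) auto
  also have "\<dots> = (\<Sum>x\<in>{0..<int p}. chi \<omega> x * \<zeta> powi (int l * x))"
    by (simp add: power_mult_distrib chi_l zeta_l)
  finally have "chi \<omega> (int l) * gauss \<omega> \<zeta> ^ l
      = (\<Sum>x\<in>{0..<int p}. chi \<omega> (int l * x) * \<zeta> powi (int l * x))"
    by (simp add: sum_distrib_left chi_mult[OF w] mult.assoc)
  also have "\<dots> = gauss \<omega> \<zeta>"
    unfolding gauss_def
  proof (rule sum_residues_reindex[OF p_pos])
    show "chi \<omega> x * \<zeta> powi x = chi \<omega> y * \<zeta> powi y" if "[x = y] (mod int p)" for x y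
      using chi_cong[OF that] powi_zeta_cong[OF that] by metis
    show "[x = y] (mod int p)" if "[int l * x = int l * y] (mod int p)" for x y
      using that coprime_p[OF pl] by (simp add: cong_mult_lcancel)
  qed
  also have "gauss \<omega> \<zeta> ^ l = gauss \<omega> \<zeta> ^ (l - 1) * gauss \<omega> \<zeta>"
    using prime_gt_0_nat[OF l(1)] by (metis power_minus_mult)
  finally have "chi \<omega> (int l) * gauss \<omega> \<zeta> ^ (l - 1) = 1"
    using g0 by (simp flip: mult.assoc)
  moreover have "l - 1 = 3 * ((l - 1) div 3)"
    using l(3) by presburger
  ultimately show ?thesis
    using gauss_cubed by (metis power_mult)
qed

end

lemma jacobi_times_conjugate:
  assumes w: "primitive_cube_root (\<omega>::'a::field)" and z: "(\<zeta>::'a) ^ p = 1" "\<zeta> \<noteq> 1"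
    and p0: "of_nat p \<noteq> (0::'a)"
  shows "jacobi \<omega> * jacobi (\<omega>\<^sup>2) = of_nat p"
proof -
  note w2 = primitive_cube_root_power2[OF w]
  have "(gauss \<omega> \<zeta>)\<^sup>2 * (gauss (\<omega>\<^sup>2) \<zeta>)\<^sup>2
      = jacobi \<omega> * jacobi (\<omega>\<^sup>2) * (gauss \<omega> \<zeta> * gauss (\<omega>\<^sup>2) \<zeta>)"
    by (simp only: gauss_squared[OF w z] gauss_squared[OF w2(1) z] w2(2) mult_ac)
  then have "of_nat p * of_nat p = jacobi \<omega> * jacobi (\<omega>\<^sup>2) * of_nat p"
    by (simp add: gauss_times_conjugate[OF w z] flip: power_mult_distrib) (simp add: power2_eq_square)
  with p0 show ?thesis by simp
qed

end

section \<open>The Jacobi sum as an Eisenstein integer\<close>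

text \<open>Every orbit has exactly three elements; the induction removes one orbit.\<close>
lemma three_dvd_card_of_order_3_action:
  assumes "finite S" and "\<And>x. x \<in> S \<Longrightarrow> f x \<in> S"
    and "\<And>x. x \<in> S \<Longrightarrow> f (f (f x)) = x" and "\<And>x. x \<in> S \<Longrightarrow> f x \<noteq> x"
  shows "3 dvd card S"
  using assms
proof (induction "card S" arbitrary: S rule: less_induct)
  case less
  show ?case
  proof (cases "S = {}")
    case False
    then obtain x where x: "x \<in> S" by blast
    have f: "f y \<in> S" "f (f (f y)) = y" "f y \<noteq> y" if "y \<in> S" for y
      using less.prems that by blast+
    let ?O = "{x, f x, f (f x)}"
    have O: "?O \<subseteq> S"
      using x f(1) by blast
    have "f (f x) \<noteq> x"
      using f(2)[OF x] f(3)[OF x] by metis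
    then have card_O: "card ?O = 3"
      using f(3)[OF x] f(3)[OF f(1)[OF x]] by simp
    have card: "card S = card (S - ?O) + 3"
      using card_O O card_Diff_subset[of ?O S] card_mono[OF less.prems(1) O] by simp
    have "3 dvd card (S - ?O)"
    proof (rule less.hyps)
      show "card (S - ?O) < card S"
        using card by simp
      show "f y \<in> S - ?O" if y: "y \<in> S - ?O" for y
      proof -
        have "y \<in> ?O" if "f y \<in> ?O"
        proof -
          have "y = f (f (f y))"
            using f(2) y by simp
          also have "\<dots> \<in> ?O"
            using that f(2)[OF x] by auto
          finally show ?thesis .
        qed
        then show ?thesis
          using y f(1) by blast
      qed
    qed (use less.prems f in auto)
    with card show ?thesis by simp
  qed simp
qed

context cubic_index
begin

definition jacobi_class :: "nat \<Rightarrow> int set" where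
  "jacobi_class i = {x \<in> {2..<int p}. ind (x * (1 - x)) mod 3 = i}"

lemma finite_jacobi_class: "finite (jacobi_class i)"
  by (rule finite_subset[of _ "{2..<int p}"]) (auto simp: jacobi_class_def)

lemma residue_unit:
  assumes "x \<in> {2..<int p}"
  shows "\<not> int p dvd x" "\<not> int p dvd 1 - x"
proof -
  show "\<not> int p dvd x"
    using assms zdvd_imp_le[of "int p" x] by auto
  have "int p dvd 1 - x \<longleftrightarrow> int p dvd x - 1"
    by (metis dvd_minus_iff minus_diff_eq)
  then show "\<not> int p dvd 1 - x"
    using assms zdvd_imp_le[of "int p" "x - 1"] by auto
qed

lemma jacobi_eq_card:
  assumes w: "primitive_cube_root (\<omega>::'a::field)"
  shows "jacobi \<omega> = of_nat (card (jacobi_class 0)) + of_nat (card (jacobi_class 1)) * \<omega>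
    + of_nat (card (jacobi_class 2)) * \<omega>\<^sup>2"
proof -
  let ?R = "{2..<int p}"
  have p1: "int p > 1"
    using prime prime_gt_1_nat by simp
  have split: "{0..<int p} = insert 0 (insert 1 ?R)"
    using p1 by auto
  have "jacobi \<omega> = (\<Sum>x\<in>?R. chi \<omega> x * chi \<omega> (1 - x))"
    unfolding jacobi_def split by (simp add: chi_def)
  also have "\<dots> = (\<Sum>x\<in>?R. of_nat (if ind (x * (1 - x)) mod 3 = 0 then 1 else 0)
      + of_nat (if ind (x * (1 - x)) mod 3 = 1 then 1 else 0) * \<omega>
      + of_nat (if ind (x * (1 - x)) mod 3 = 2 then 1 else 0) * \<omega>\<^sup>2)"
  proof (rule sum.cong[OF refl])
    fix x assume x: "x \<in> ?R"
    have "chi \<omega> x * chi \<omega> (1 - x) = chi \<omega> (x * (1 - x))"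
      by (simp only: chi_mult[OF w])
    also have "\<dots> = \<omega> ^ ind (x * (1 - x))"
      using residue_unit[OF x] by (simp add: chi_def p_dvd_mult_iff)
    also have "\<dots> = \<omega> ^ (ind (x * (1 - x)) mod 3)"
      by (rule primitive_cube_root_power_eq[OF w]) simp
    finally have "chi \<omega> x * chi \<omega> (1 - x) = \<omega> ^ (ind (x * (1 - x)) mod 3)" .
    moreover have "ind (x * (1 - x)) mod 3 \<in> {0, 1, 2}" by auto
    ultimately show "chi \<omega> x * chi \<omega> (1 - x) =
      of_nat (if ind (x * (1 - x)) mod 3 = 0 then 1 else 0)
      + of_nat (if ind (x * (1 - x)) mod 3 = 1 then 1 else 0) * \<omega>
      + of_nat (if ind (x * (1 - x)) mod 3 = 2 then 1 else 0) * \<omega>\<^sup>2"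
      by auto
  qed
  also have "\<dots> = of_nat (card (jacobi_class 0)) + of_nat (card (jacobi_class 1)) * \<omega>
    + of_nat (card (jacobi_class 2)) * \<omega>\<^sup>2"
    by (simp add: sum.distrib jacobi_class_def sum.If_cases Int_def
        flip: sum_distrib_right of_nat_sum)
  finally show ?thesis .
qed

lemma mult_cong_1_imp_cong:
  assumes "[u * x = 1] (mod int p)" "[u * y = 1] (mod int p)"
  shows "[x = y] (mod int p)"
proof -
  have "\<not> int p dvd u"
  proof
    assume "int p dvd u"
    then have "[u * x = 0] (mod int p)"
      by (simp add: cong_0_iff)
    with assms(1) have "[1 = 0] (mod int p)"
      by (meson cong_sym cong_trans)
    then show False
      using p_not_dvd_1 by (simp add: cong_0_iff)
  qed
  moreover have "[u * x = u * y] (mod int p)"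
    using assms by (meson cong_sym cong_trans)
  ultimately show ?thesis
    using coprime_p by (simp add: cong_mult_lcancel)
qed

lemma ind_mult_dvd:
  assumes "\<not> int p dvd u" "3 dvd ind u" "\<not> int p dvd x"
  shows "ind (u * x) mod 3 = ind x mod 3"
  using ind_mult[OF assms(1,3)] assms(2) by (auto simp: cong_def mod_add_left_eq elim!: dvdE)

lemma three_dvd_ind_cube:
  assumes "\<not> int p dvd u"
  shows "3 dvd ind (u ^ 3)"
proof -
  have "[ind (u * (u * u)) = ind u + ind (u * u)] (mod 3)" "[ind (u * u) = ind u + ind u] (mod 3)"
    using ind_mult[of u "u * u"] ind_mult[of u u] assms by (simp_all add: p_dvd_mult_iff)
  then show ?thesis
    unfolding power3_eq_cube mult.assoc cong_def by presburger
qed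

text \<open>The map that sends \<open>x\<close> to \<open>1 / (1 - x)\<close> has order three on the residues other than 0 and 1, and
  it preserves the cubic class of \<open>x * (1 - x)\<close>, because it changes this number by the factor \<open>- 1\<close> and
  a cube. A fixed point satisfies \<open>x * (1 - x) = 1\<close>, so fixed points occur in the class 0 only.\<close>
lemma three_dvd_card_jacobi_class:
  assumes i: "i \<noteq> 0"
  shows "3 dvd card (jacobi_class i)"
proof -
  \<comment> \<open>By Fermat, the power is the inverse of \<open>1 - x\<close>.\<close>
  define f where "f x = (1 - x) ^ (p - 2) mod int p" for x :: int
  have p2: "p \<ge> 2"
    using prime prime_ge_2_nat by blast
  have f: "[(1 - x) * f x = 1] (mod int p)" if "x \<in> {2..<int p}" for x
  proof -
    have "[(1 - x) * f x = (1 - x) * (1 - x) ^ (p - 2)] (mod int p)"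
      unfolding f_def by (intro cong_mult cong_refl cong_mod_leftI)
    also have "(1 - x) * (1 - x) ^ (p - 2) = (1 - x) ^ (p - 1)"
      using p2 by (metis Suc_diff_Suc Suc_1 Suc_le_lessD power_Suc)
    also have "[(1 - x) ^ (p - 1) = 1] (mod int p)"
      using fermat_theorem_int[OF prime residue_unit(2)[OF that]] .
    finally show ?thesis .
  qed
  have range: "f x \<in> {2..<int p}" if x: "x \<in> {2..<int p}" for x
  proof -
    have "f x \<noteq> 0"
      using f[OF x] p_not_dvd_1 by (metis cong_dvd_iff dvd_0_right mult_zero_right)
    moreover have "f x \<noteq> 1"
    proof
      assume "f x = 1"
      then have "[1 - x - 1 = 1 - 1] (mod int p)"
        using f[OF x] by (intro cong_diff cong_refl) simp
      then show False
        using residue_unit(1)[OF x] by (simp add: cong_0_iff)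
    qed
    moreover have "0 \<le> f x" "f x < int p"
      using p_pos by (simp_all add: f_def)
    ultimately show ?thesis by simp
  qed
  have class_f: "ind (f x * (1 - f x)) mod 3 = ind (x * (1 - x)) mod 3"
    if x: "x \<in> {2..<int p}" for x
  proof -
    let ?s = "f x" and ?u = "1 - x"
    have u: "\<not> int p dvd ?u" "\<not> int p dvd ?u ^ 3"
      using residue_unit[OF x] prime prime_dvd_power[of "int p" "1 - x" 3] by auto
    have t: "\<not> int p dvd x * ?u" "\<not> int p dvd ?s * (1 - ?s)"
      using residue_unit[OF x] residue_unit[OF range[OF x]] p_dvd_mult_iff by blast+
    have "[(?u * ?s) * (?u * ?u - ?u * (?u * ?s)) = 1 * (?u * ?u - ?u * 1)] (mod int p)"
      using f[OF x] by (intro cong_mult cong_diff cong_refl)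
    then have "[?u ^ 3 * (?s * (1 - ?s)) = - 1 * (x * ?u)] (mod int p)"
      by (simp add: algebra_simps power3_eq_cube)
    then have "ind (?u ^ 3 * (?s * (1 - ?s))) = ind (- 1 * (x * ?u))"
      by (rule ind_cong)
    then show ?thesis
      using ind_mult_dvd[OF u(2) three_dvd_ind_cube[OF u(1)] t(2)]
        ind_mult_dvd[of "- 1", OF _ ind_minus_1 t(1)] p_not_dvd_1 by simp
  qed
  show ?thesis
  proof (rule three_dvd_card_of_order_3_action[of _ f])
    show "finite (jacobi_class i)"
      by (rule finite_jacobi_class)
    fix x assume "x \<in> jacobi_class i"
    then have x: "x \<in> {2..<int p}" and xi: "ind (x * (1 - x)) mod 3 = i"
      by (simp_all add: jacobi_class_def)
    show "f x \<in> jacobi_class i"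
      using range[OF x] class_f[OF x] xi by (simp add: jacobi_class_def)
    show "f x \<noteq> x"
    proof
      assume "f x = x"
      then have "ind (x * (1 - x)) = ind 1"
        using f[OF x] by (intro ind_cong) (simp add: mult.commute)
      with xi i ind_1 show False by auto
    qed
    let ?s = "f x"
    let ?t = "f ?s"
    have s: "?s \<in> {2..<int p}" and t: "?t \<in> {2..<int p}"
      using range x by blast+
    have "[?s * ((1 - ?t) * x) = ?s] (mod int p)"
    proof -
      have "[?s * ((1 - ?t) * x) = ?s - (1 - x) * ?s + ((1 - x) * ?s) * ?t - ?s * ?t] (mod int p)"
        by (simp add: algebra_simps)
      also have "[?s - (1 - x) * ?s + ((1 - x) * ?s) * ?t - ?s * ?t
          = ?s - 1 + 1 * ?t - ?s * ?t] (mod int p)"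
        using f[OF x] by (intro cong_diff cong_add cong_mult cong_refl)
      also have "?s - 1 + 1 * ?t - ?s * ?t = ?s - 1 + (1 - ?s) * ?t"
        by (simp add: algebra_simps)
      also have "[?s - 1 + (1 - ?s) * ?t = ?s - 1 + 1] (mod int p)"
        using f[OF s] by (intro cong_add cong_refl)
      finally show ?thesis by simp
    qed
    then have "[?s * ((1 - ?t) * x) = ?s * 1] (mod int p)"
      by simp
    then have "[(1 - ?t) * x = 1] (mod int p)"
      by (rule cong_mult_lcancel[OF coprime_p[OF residue_unit(1)[OF s]], THEN iffD1])
    with f[OF t] have "[f ?t = x] (mod int p)"
      by (rule mult_cong_1_imp_cong)
    then show "f (f (f x)) = x"
      using range[OF t] x by (metis atLeastLessThan_iff cong_less_imp_eq_int order_trans zero_le_numeral)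
  qed
qed

text \<open>The coefficients come from \<open>1 + \<omega> + \<omega>\<^sup>2 = 0\<close> and the sizes of the three classes; they are the
  same for every field.\<close>
lemma jacobi_integer_form:
  "\<exists>A B. int p = A\<^sup>2 - A * B + B\<^sup>2 \<and> 3 dvd B \<and>
    (\<forall>\<omega>::'a::field. primitive_cube_root \<omega> \<longrightarrow> jacobi \<omega> = of_int A + of_int B * \<omega>)"
proof -
  let ?N = "\<lambda>i. int (card (jacobi_class i))"
  define A where "A = ?N 0 - ?N 2"
  define B where "B = ?N 1 - ?N 2"
  have J: "jacobi \<omega> = of_int A + of_int B * \<omega>" if w: "primitive_cube_root \<omega>"
    for \<omega> :: "'b::field"
  proof -
    have w2: "\<omega>\<^sup>2 = - 1 - \<omega>"
      using primitive_cube_root_sum[OF w] by (simp add: eq_neg_iff_add_eq_0 algebra_simps)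
    show ?thesis
      unfolding jacobi_eq_card[OF w] w2 A_def B_def by (simp add: algebra_simps)
  qed
  have "3 dvd ?N 1" "3 dvd ?N 2"
    using three_dvd_card_jacobi_class[of 1] three_dvd_card_jacobi_class[of 2] by presburger+
  then have B: "3 dvd B"
    unfolding B_def by (rule dvd_diff)
  \<comment> \<open>The norm of the Jacobi sum is computed over the complex numbers, where an identity between
    integers can be read off.\<close>
  have "int p = A\<^sup>2 - A * B + B\<^sup>2"
  proof -
    obtain \<omega> :: complex where "\<omega> ^ 3 = 1" "\<omega> \<noteq> 1"
      using nontrivial_root_of_unity_exists[of 3, where 'a = complex] by auto
    then have w: "primitive_cube_root \<omega>"
      by (simp add: primitive_cube_root_def)
    obtain \<zeta> :: complex where z: "\<zeta> ^ p = 1" "\<zeta> \<noteq> 1"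
      using nontrivial_root_of_unity_exists[of p, where 'a = complex] prime prime_gt_1_nat by auto
    note w2 = primitive_cube_root_power2[OF w]
    have s: "\<omega>\<^sup>2 = - 1 - \<omega>"
      using primitive_cube_root_sum[OF w] by (simp add: eq_neg_iff_add_eq_0 algebra_simps)
    have "of_nat p = (of_int A + of_int B * \<omega>) * (of_int A + of_int B * \<omega>\<^sup>2)"
      using jacobi_times_conjugate[OF w z] J[OF w] J[OF w2(1)] prime prime_gt_0_nat[of p] by simp
    also have "\<dots> = (of_int A)\<^sup>2 + of_int A * of_int B * (\<omega> + \<omega>\<^sup>2) + (of_int B)\<^sup>2 * \<omega> ^ 3"
      by (simp add: algebra_simps power2_eq_square power3_eq_cube)
    also have "\<dots> = of_int (A\<^sup>2 - A * B + B\<^sup>2)"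
      using w by (simp add: s primitive_cube_root_def)
    finally have "of_int (int p) = (of_int (A\<^sup>2 - A * B + B\<^sup>2) :: complex)"
      by simp
    then show ?thesis
      by (simp only: of_int_eq_iff)
  qed
  with B J show ?thesis by blast
qed

end

text \<open>The prime \<open>p\<close> divides \<open>L\<^sup>2 M'\<^sup>2 - L'\<^sup>2 M\<^sup>2\<close>, hence \<open>L M' - L' M\<close> after a change of the sign of
  \<open>M'\<close>. By the identity \<open>16 p\<^sup>2 = (L L' + 27 M M')\<^sup>2 + 27 (L M' - L' M)\<^sup>2\<close> this multiple of \<open>p\<close> is too
  small to be anything but 0.\<close>
lemma representation_27_unique:
  fixes p L M L' M' :: int
  assumes p: "prime p" and e: "4 * p = L\<^sup>2 + 27 * M\<^sup>2" "4 * p = L'\<^sup>2 + 27 * M'\<^sup>2"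
  shows "L\<^sup>2 = L'\<^sup>2 \<and> M\<^sup>2 = M'\<^sup>2"
proof -
  have p0: "p > 0"
    using p prime_gt_0_int by blast
  have main: "L\<^sup>2 = L'\<^sup>2 \<and> M\<^sup>2 = M'\<^sup>2"
    if d: "p dvd L * K - L' * M" and eK: "4 * p = L'\<^sup>2 + 27 * K\<^sup>2" "K\<^sup>2 = M'\<^sup>2" for K
  proof -
    obtain k where k: "L * K - L' * M = p * k"
      using d by blast
    have "16 * p\<^sup>2 = (4 * p) * (4 * p)"
      by (simp add: power2_eq_square)
    also have "\<dots> = (L * L' + 27 * M * K)\<^sup>2 + 27 * (L * K - L' * M)\<^sup>2"
      unfolding e(1) by (subst (2) e(1)[symmetric], subst eK(1)) (simp add: power2_eq_square algebra_simps)
    finally have "16 * p\<^sup>2 = (L * L' + 27 * M * K)\<^sup>2 + 27 * (p * k)\<^sup>2"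
      unfolding k .
    then have "27 * (p * k)\<^sup>2 \<le> 16 * p\<^sup>2"
      using zero_le_power2[of "L * L' + 27 * M * K"] by linarith
    then have "27 * k\<^sup>2 * p\<^sup>2 \<le> 16 * p\<^sup>2"
      by (simp only: power_mult_distrib mult_ac)
    then have "27 * k\<^sup>2 \<le> 16"
      using p0 by simp
    then have "k = 0"
      using zero_le_power2[of k] by (smt (verit) power2_less_eq_zero_iff)
    with k have LK: "L * K = L' * M" by simp
    have "(4 * p - 27 * M\<^sup>2) * K\<^sup>2 = (4 * p - 27 * K\<^sup>2) * M\<^sup>2"
    proof -
      have "L\<^sup>2 * K\<^sup>2 = L'\<^sup>2 * M\<^sup>2"
        using LK by (metis power_mult_distrib)
      then show ?thesis
        using e(1) eK(1) by simp
    qed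
    then have "4 * p * K\<^sup>2 = 4 * p * M\<^sup>2"
      by (simp add: algebra_simps)
    then have "K\<^sup>2 = M\<^sup>2"
      using p0 by simp
    with e eK show ?thesis by simp
  qed
  have "(L * M' - L' * M) * (L * - M' - L' * M) = L'\<^sup>2 * M\<^sup>2 - L\<^sup>2 * M'\<^sup>2"
    by (simp add: algebra_simps power2_eq_square)
  also have "\<dots> = (4 * p - 27 * M'\<^sup>2) * M\<^sup>2 - (4 * p - 27 * M\<^sup>2) * M'\<^sup>2"
    using e by simp
  also have "\<dots> = p * (4 * M\<^sup>2 - 4 * M'\<^sup>2)"
    by (simp add: algebra_simps)
  finally have "p dvd (L * M' - L' * M) * (L * - M' - L' * M)"
    by simp
  then consider "p dvd L * M' - L' * M" | "p dvd L * - M' - L' * M"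
    using p prime_dvd_mult_iff by blast
  then show ?thesis
    using main[of M'] main[of "- M'"] e(2) by cases simp_all
qed

section \<open>The cubic character of 7\<close>

text \<open>A type with seven elements; the ring of residues indexed by it is the field with seven elements.\<close>
typedef seven = "{0..<7::nat}"
  by (rule exI[of _ 0]) simp

instance seven :: prime_card
proof
  have "card (UNIV :: seven set) = 7"
    using type_definition.card[OF type_definition_seven] by simp
  then show "prime (card (UNIV :: seven set))" by simp
qed

context cubic_index
begin

text \<open>In characteristic 7 the cube root of unity can be taken to be 2, so the Jacobi sum becomes the
  integer \<open>A + 2 * B\<close> and the reciprocity step a congruence modulo 7.\<close>
lemma three_dvd_ind_7_iff:
  fixes A B :: int
  assumes p: "p \<noteq> 7" and AB: "int p = A\<^sup>2 - A * B + B\<^sup>2"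
    and J: "\<And>\<omega> :: seven mod_ring alg_closure. primitive_cube_root \<omega> \<Longrightarrow>
      jacobi \<omega> = of_int A + of_int B * \<omega>"
  shows "3 dvd ind 7 \<longleftrightarrow> 7 dvd B \<or> 7 dvd 2 * A - B"
proof -
  have "CARD(seven) = 7"
    using type_definition.card[OF type_definition_seven] by simp
  then have CHAR: "CHAR(seven mod_ring alg_closure) = 7"
    by simp
  have eq_iff: "(of_int x :: seven mod_ring alg_closure) = of_int y \<longleftrightarrow> [x = y] (mod 7)" for x y
    using of_int_eq_iff_cong_CHAR[of x y, where 'a = "seven mod_ring alg_closure"] CHAR by simp
  have nd: "\<not> 7 dvd p"
    using p prime primes_dvd_imp_eq[of 7 p] by auto
  then have "of_nat p \<noteq> (0 :: seven mod_ring alg_closure)"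
    using of_nat_eq_0_iff_char_dvd[of p, where 'a = "seven mod_ring alg_closure"] CHAR by simp
  then obtain \<zeta> :: "seven mod_ring alg_closure" where z: "\<zeta> ^ p = 1" "\<zeta> \<noteq> 1"
    using nontrivial_root_of_unity_exists prime prime_gt_1_nat by blast
  have "(of_int 8 :: seven mod_ring alg_closure) = of_int 1"
    "(of_int 2 :: seven mod_ring alg_closure) \<noteq> of_int 1"
    unfolding eq_iff by (simp_all add: cong_def)
  then have w: "primitive_cube_root (2 :: seven mod_ring alg_closure)"
    by (simp add: primitive_cube_root_def)
  have "chi 2 (int 7) * (of_nat p * jacobi 2) ^ ((7 - 1) div 3) = (1 :: seven mod_ring alg_closure)"
    using p by (intro chi_times_jacobi_power[OF w z _ CHAR]) auto
  moreover have "of_nat p * jacobi 2 = (of_int (int p * (A + 2 * B)) :: seven mod_ring alg_closure)"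
    by (simp add: J[OF w] mult.commute)
  moreover have "chi 2 7 = (2 :: seven mod_ring alg_closure) ^ ind 7"
    using p prime primes_dvd_imp_eq[of p 7] int_dvd_int_iff[of p 7] by (auto simp: chi_def)
  ultimately have "(2 :: seven mod_ring alg_closure) ^ ind 7 * of_int ((int p * (A + 2 * B))\<^sup>2) = of_int 1"
    by simp
  then have "3 dvd ind 7 \<longleftrightarrow> (of_int ((int p * (A + 2 * B))\<^sup>2) :: seven mod_ring alg_closure) = of_int 1"
    unfolding primitive_cube_root_power_eq_1_iff[OF w, symmetric] by (metis mult.commute mult_1 of_int_1)
  also have "\<dots> \<longleftrightarrow> [(int p * (A + 2 * B))\<^sup>2 = 1] (mod 7)"
    by (rule eq_iff)
  also have "\<dots> \<longleftrightarrow> 7 dvd B \<or> 7 dvd 2 * A - B"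
  proof -
    have n0: "(A\<^sup>2 - A * B + B\<^sup>2) mod 7 \<noteq> 0"
      using nd AB by (metis dvd_eq_mod_eq_0 int_dvd_int_iff of_nat_numeral)
    define a where "a = A mod 7"
    define b where "b = B mod 7"
    have ab: "a \<in> {0,1,2,3,4,5,6}" "b \<in> {0,1,2,3,4,5,6}"
      unfolding a_def b_def by (simp_all, presburger+)
    have c: "[A = a] (mod 7)" "[B = b] (mod 7)"
      by (simp_all add: a_def b_def)
    have 1: "[A\<^sup>2 - A * B + B\<^sup>2 = a\<^sup>2 - a * b + b\<^sup>2] (mod 7)"
      using c by (intro cong_add cong_diff cong_mult cong_pow)
    have 2: "[((A\<^sup>2 - A * B + B\<^sup>2) * (A + 2 * B))\<^sup>2 = ((a\<^sup>2 - a * b + b\<^sup>2) * (a + 2 * b))\<^sup>2] (mod 7)"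
      using c by (intro cong_add cong_diff cong_mult cong_pow cong_refl)
    have 3: "[2 * A - B = 2 * a - b] (mod 7)"
      using c by (intro cong_diff cong_mult cong_refl)
    have "\<forall>a\<in>{0,1,2,3,4,5,6}. \<forall>b\<in>{0,1,2,3,4,5,6::int}. (a\<^sup>2 - a * b + b\<^sup>2) mod 7 \<noteq> 0 \<longrightarrow>
        (((a\<^sup>2 - a * b + b\<^sup>2) * (a + 2 * b))\<^sup>2 mod 7 = 1 \<longleftrightarrow> b mod 7 = 0 \<or> (2 * a - b) mod 7 = 0)"
      by simp
    then have "((a\<^sup>2 - a * b + b\<^sup>2) * (a + 2 * b))\<^sup>2 mod 7 = 1 \<longleftrightarrow> b mod 7 = 0 \<or> (2 * a - b) mod 7 = 0"
      using ab n0 1 unfolding cong_def by metis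
    then show ?thesis
      using 2 3 c(2) unfolding AB dvd_eq_mod_eq_0 cong_def by simp
  qed
  finally show ?thesis .
qed

end

text \<open>The discrete logarithm modulo 3 is a cubic character.\<close>
lemma cubic_index_exists:
  assumes p: "prime p" "[p = 1] (mod 3)"
  shows "\<exists>ind. cubic_index p ind \<and>
    (\<forall>x. \<not> int p dvd x \<longrightarrow> (3 dvd ind x \<longleftrightarrow> [x ^ ((p - 1) div 3) = 1] (mod int p)))"
proof -
  have "p > 1"
    using p prime_gt_1_nat by auto
  have d3: "3 dvd p - 1"
    using p(2) \<open>p > 1\<close> unfolding cong_def by presburger
  obtain g dlog where dlog: "is_discrete_log p g dlog"
    using discrete_log_exists[OF p(1)] by blast
  note log = is_discrete_logD[OF dlog]
  have "cubic_index p dlog"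
  proof
    show "prime p" by fact
    show "dlog x = dlog y" if "[x = y] (mod int p)" for x y
      using log(3) that .
    show "[dlog (x * y) = dlog x + dlog y] (mod 3)" if "\<not> int p dvd x" "\<not> int p dvd y" for x y
    proof -
      have "\<not> int p dvd x * y"
        using that p(1) by (simp add: prime_dvd_mult_iff)
      then have "[g ^ dlog (x * y) = x * y] (mod int p)"
        by (rule log(1))
      moreover have "[g ^ (dlog x + dlog y) = x * y] (mod int p)"
        unfolding power_add using log(1) that by (intro cong_mult)
      ultimately have "[g ^ dlog (x * y) = g ^ (dlog x + dlog y)] (mod int p)"
        by (meson cong_sym cong_trans)
      then have "[dlog (x * y) = dlog x + dlog y] (mod (p - 1))"
        by (simp only: log(2))
      then show ?thesis
        using d3 by (rule cong_dvd_modulus_nat)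
    qed
    show "\<exists>x. \<not> int p dvd x \<and> \<not> 3 dvd dlog x"
    proof -
      obtain n where n: "power_nonresidue p 3 (int n)"
        using power_nonresidue_exists[OF p(1) d3] by auto
      then have u: "\<not> int p dvd int n"
        using coprime_prime_iff_int[OF p(1)] by (simp add: power_nonresidue_def)
      have "\<not> [int n ^ ((p - 1) div 3) = 1] (mod int p)"
        using n power_residue_iff[OF p(1) d3, of "int n"] by (simp add: power_nonresidue_def)
      then have "\<not> 3 dvd dlog (int n)"
        using power_eq_one_iff_dvd_dlog[OF p(1) d3 dlog u] by simp
      with u show ?thesis by blast
    qed
  qed
  then show ?thesis
    using power_eq_one_iff_dvd_dlog[OF p(1) d3 dlog] by blast
qed

lemma seven_cubic_residue_iff:
  fixes L M :: int
  assumes p: "prime p" "[p = 1] (mod 3)" "p \<noteq> 7" and LM: "4 * int p = L\<^sup>2 + 27 * M\<^sup>2"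
  shows "[7 ^ ((p - 1) div 3) = 1] (mod int p) \<longleftrightarrow> 7 dvd L \<or> 7 dvd M"
proof -
  obtain ind where ind: "cubic_index p ind"
    and ind_iff: "\<And>x. \<not> int p dvd x \<Longrightarrow> 3 dvd ind x \<longleftrightarrow> [x ^ ((p - 1) div 3) = 1] (mod int p)"
    using cubic_index_exists[OF p(1,2)] by blast
  interpret cubic_index p ind by (rule ind)
  obtain A B where AB: "int p = A\<^sup>2 - A * B + B\<^sup>2" "3 dvd B"
    and J: "\<And>\<omega> :: seven mod_ring alg_closure. primitive_cube_root \<omega> \<Longrightarrow>
      jacobi \<omega> = of_int A + of_int B * \<omega>"
    using jacobi_integer_form[where 'a = "seven mod_ring alg_closure"] by blast
  obtain N where N: "B = 3 * N"
    using AB(2) by blast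
  have "4 * int p = (2 * A - B)\<^sup>2 + 27 * N\<^sup>2"
    by (simp add: AB(1) N power2_eq_square algebra_simps)
  then have eq: "L\<^sup>2 = (2 * A - B)\<^sup>2" "M\<^sup>2 = N\<^sup>2"
    using representation_27_unique[OF _ LM] p(1) by auto
  have sq: "7 dvd x \<longleftrightarrow> 7 dvd x\<^sup>2" for x :: int
    by (simp add: prime_dvd_power_iff)
  have "\<not> int p dvd 7"
    using p(1,3) primes_dvd_imp_eq[of p 7] int_dvd_int_iff[of p 7] by auto
  then have "[7 ^ ((p - 1) div 3) = 1] (mod int p) \<longleftrightarrow> 7 dvd B \<or> 7 dvd 2 * A - B"
    using ind_iff three_dvd_ind_7_iff[OF p(3) AB(1) J] by simp
  also have "7 dvd B \<longleftrightarrow> 7 dvd N"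
    unfolding N by presburger
  finally show ?thesis
    using eq sq[of L] sq[of M] sq[of N] sq[of "2 * A - B"] by auto
qed

section \<open>The primes \<open>p(a, b)\<close>\<close>

lemma cert_m_plus_1: "cert_m a b + 1 = 2 ^ a * 3 ^ b"
  by (simp add: cert_m_def)

lemma cert_m_gt_1:
  assumes "a \<ge> 1" "b \<ge> 1"
  shows "cert_m a b > 1"
proof -
  have "(2::nat) ^ 1 * 3 ^ 1 \<le> 2 ^ a * 3 ^ b"
    using assms by (intro mult_mono power_increasing) auto
  then show ?thesis
    using cert_m_plus_1[of a b] by simp
qed

lemma cert_p_minus_1: "cert_p a b - 1 = 2 ^ a * 3 ^ (b + 1) * cert_m a b"
  unfolding cert_p_def cert_m_plus_1 by simp

lemma cert_p_gt:
  assumes "a \<ge> 1" "b \<ge> 1"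
  shows "cert_p a b > 7"
  unfolding cert_p_def
  using mult_le_mono[of 2 "cert_m a b" 3 "cert_m a b + 1"] cert_m_gt_1[OF assms] by simp

lemma dvd_cert_p_minus_1:
  assumes "a \<ge> 1"
  shows "2 dvd cert_p a b - 1" "3 dvd cert_p a b - 1"
  unfolding cert_p_minus_1 using assms by (auto intro!: dvd_mult2)

lemma prime_cert_p_of_valid_pair:
  assumes "a \<ge> 1" "b \<ge> 1" "valid_pair (cert_p a b) w2 w3"
  shows "prime (cert_p a b)"
proof (rule prime_of_valid_pair[OF cert_p_minus_1 _ _ assms(3)])
  let ?m = "cert_m a b"
  have "2 ^ a * 3 ^ (b + 1) = 3 * (?m + 1)"
    by (simp only: cert_m_plus_1) simp
  moreover have "cert_p a b < (3 * (?m + 1))\<^sup>2"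
    by (simp add: cert_p_def power2_eq_square algebra_simps)
  ultimately show "cert_p a b < (2 ^ a * 3 ^ (b + 1))\<^sup>2"
    by simp
  show "2 \<le> cert_p a b"
    using cert_p_gt[OF assms(1,2)] by simp
qed

lemma power_mod_period:
  fixes c n :: nat
  assumes "c ^ k mod n = 1 mod n"
  shows "c ^ a mod n = c ^ (a mod k) mod n"
proof -
  have "[c ^ k = 1] (mod n)"
    using assms by (simp add: cong_def)
  then have "[(c ^ k) ^ (a div k) * c ^ (a mod k) = 1 ^ (a div k) * c ^ (a mod k)] (mod n)"
    by (intro cong_mult cong_pow cong_refl)
  moreover have "(c ^ k) ^ (a div k) * c ^ (a mod k) = c ^ a"
    by (simp flip: power_mult power_add)
  ultimately show ?thesis
    by (simp add: cong_def)
qed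

text \<open>Modulo 5, the powers of 2 and of 3 have period 4, so both sides depend only on \<open>a mod 4\<close> and
  \<open>b mod 4\<close>. With \<open>u = 2 ^ a * 3 ^ b\<close> the number \<open>p\<close> is \<open>3 * u\<^sup>2 - 3 * u + 1\<close>; the subtraction is moved to
  the other side, because it is truncated on natural numbers.\<close>
lemma five_case_iff: "five_case a b \<longleftrightarrow> cert_p a b mod 5 \<in> {2, 3}"
proof -
  define r where "r = a mod 4"
  define s where "s = b mod 4"
  have rs: "r \<in> {0,1,2,3}" "s \<in> {0,1,2,3}"
    unfolding r_def s_def by (simp_all, presburger+)
  have "[int a = int r] (mod 4)" "[int b = int s] (mod 4)"
    by (simp_all add: r_def s_def cong_def zmod_int)
  then have "[int a - int b = int r - int s] (mod 4)"
    by (rule cong_diff)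
  then have five: "five_case a b \<longleftrightarrow> (int r - int s) mod 4 = 1 \<or> (int r - int s) mod 4 = 2"
    unfolding five_case_def cong_def by simp
  have "[2 ^ a = 2 ^ r] (mod (5::nat))" "[3 ^ b = 3 ^ s] (mod (5::nat))"
    unfolding cong_def r_def s_def by (rule power_mod_period; simp)+
  then have u: "[2 ^ a * 3 ^ b = 2 ^ r * 3 ^ s] (mod (5::nat))"
    by (rule cong_mult)
  have "cert_p a b + 3 * (2 ^ a * 3 ^ b) = 3 * (2 ^ a * 3 ^ b)\<^sup>2 + 1"
    by (simp add: cert_p_def power2_eq_square algebra_simps flip: cert_m_plus_1)
  moreover have "[cert_p a b + 3 * (2 ^ a * 3 ^ b) = cert_p a b + 3 * (2 ^ r * 3 ^ s)] (mod 5)"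
    by (intro cong_add cong_mult[of 3 3] cong_refl u)
  moreover have "[3 * (2 ^ a * 3 ^ b)\<^sup>2 + 1 = 3 * (2 ^ r * 3 ^ s)\<^sup>2 + 1] (mod (5::nat))"
    by (intro cong_add cong_mult[of 3 3] cong_pow cong_refl u)
  ultimately have "[cert_p a b + 3 * (2 ^ r * 3 ^ s) = 3 * (2 ^ r * 3 ^ s)\<^sup>2 + 1] (mod 5)"
    by (simp add: cong_def)
  moreover have "\<forall>r\<in>{0,1,2,3}. \<forall>s\<in>{0,1,2,3::nat}. \<forall>c\<in>{0,1,2,3,4::nat}.
      (c + 3 * (2 ^ r * 3 ^ s)) mod 5 = (3 * (2 ^ r * 3 ^ s)\<^sup>2 + 1) mod 5 \<longrightarrow>
      ((int r - int s) mod 4 = 1 \<or> (int r - int s) mod 4 = 2 \<longleftrightarrow> c = 2 \<or> c = 3)"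
    by simp
  moreover have "(cert_p a b mod 5 + 3 * (2 ^ r * 3 ^ s)) mod 5 = (cert_p a b + 3 * (2 ^ r * 3 ^ s)) mod 5"
    by (simp add: mod_add_left_eq)
  moreover have "cert_p a b mod 5 \<in> {0,1,2,3,4}"
    by simp presburger
  ultimately have "(int r - int s) mod 4 = 1 \<or> (int r - int s) mod 4 = 2
      \<longleftrightarrow> cert_p a b mod 5 = 2 \<or> cert_p a b mod 5 = 3"
    using rs unfolding cong_def by metis
  with five show ?thesis by simp
qed

lemma five_quadratic_nonresidue_iff:
  assumes p: "prime p" "p > 5"
  shows "power_nonresidue p 2 5 \<longleftrightarrow> p mod 5 \<in> {2, 3}"
proof -
  have n5: "\<not> int p dvd 5"
    using zdvd_imp_le[of "int p" 5] p(2) by auto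
  have "\<not> 5 dvd p"
    using p primes_dvd_imp_eq[of 5 p] by auto
  then have np: "\<not> [int p = 0] (mod 5)"
    by (metis cong_0_iff int_dvd_int_iff of_nat_numeral)
  have "power_nonresidue p 2 5 \<longleftrightarrow> Legendre 5 (int p) = - 1"
    using n5 coprime_prime_iff_int[OF p(1), of 5]
    by (auto simp: power_nonresidue_def Legendre_def QuadRes_def cong_0_iff)
  also have "\<dots> \<longleftrightarrow> Legendre (int p) 5 = - 1"
  proof -
    have "Legendre (int p) (int 5) * Legendre (int 5) (int p)
        = (- 1) ^ ((p - 1) div 2 * ((5 - 1) div 2))"
      using p by (intro Quadratic_Reciprocity) auto
    then have "Legendre (int p) 5 * Legendre 5 (int p) = 1"
      by (simp add: power_mult mult.commute)
    then show ?thesis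
      by (auto simp: Legendre_def split: if_splits)
  qed
  also have "\<dots> \<longleftrightarrow> \<not> QuadRes 5 (int p)"
    using np by (simp add: Legendre_def)
  also have "\<dots> \<longleftrightarrow> p mod 5 \<in> {2, 3}"
  proof -
    have "QuadRes 5 (int p) \<longleftrightarrow> int p mod 5 = 1 \<or> int p mod 5 = 4"
    proof
      assume "QuadRes 5 (int p)"
      then obtain y where "y\<^sup>2 mod 5 = int p mod 5"
        by (auto simp: QuadRes_def cong_def)
      then have y: "(y mod 5)\<^sup>2 mod 5 = int p mod 5"
        by (simp add: power_mod)
      have "y mod 5 = 0 \<or> y mod 5 = 1 \<or> y mod 5 = 2 \<or> y mod 5 = 3 \<or> y mod 5 = 4"
        by presburger
      then show "int p mod 5 = 1 \<or> int p mod 5 = 4"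
        using y np by (auto simp: cong_def)
    next
      assume "int p mod 5 = 1 \<or> int p mod 5 = 4"
      then have "[1\<^sup>2 = int p] (mod 5) \<or> [2\<^sup>2 = int p] (mod 5)"
        by (auto simp: cong_def)
      then show "QuadRes 5 (int p)"
        unfolding QuadRes_def by blast
    qed
    moreover have "int p mod 5 \<noteq> 0"
      using np by (simp add: cong_def)
    moreover have "int p mod 5 = int (p mod 5)"
      by (simp add: zmod_int)
    moreover have "p mod 5 < 5" by simp
    ultimately show ?thesis by auto
  qed
  finally show ?thesis .
qed

lemma valid_witness_5_iff:
  assumes "a \<ge> 1" "b \<ge> 1" "prime (cert_p a b)"
  shows "valid_witness (cert_p a b) 2 5 \<longleftrightarrow> five_case a b"
  using valid_witness_iff_power_nonresidue[OF assms(3) dvd_cert_p_minus_1(1)[OF assms(1)]]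
    five_quadratic_nonresidue_iff[OF assms(3)] cert_p_gt[OF assms(1,2)] five_case_iff by simp

text \<open>The explicit representation \<open>4 p = (3 m + 1)\<^sup>2 + 27 M\<^sup>2\<close> with \<open>M = (m + 1) / 3\<close> is what makes the form
  of \<open>p\<close> special: \<open>M\<close> is a product of powers of 2 and 3, so 7 can only divide \<open>3 m + 1\<close>.\<close>
lemma valid_witness_7_iff:
  assumes ab: "a \<ge> 1" "b \<ge> 1" and p: "prime (cert_p a b)"
  shows "valid_witness (cert_p a b) 3 7 \<longleftrightarrow> seven_case a b"
proof -
  let ?p = "cert_p a b"
  let ?L = "3 * int (cert_m a b) + 1"
  let ?M = "2 ^ a * 3 ^ (b - 1) :: int"
  note d3 = dvd_cert_p_minus_1(2)[OF ab(1), of b]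
  have p7: "?p > 7"
    by (rule cert_p_gt[OF ab])
  have M: "3 * ?M = int (cert_m a b) + 1"
  proof -
    have "3 * ?M = 2 ^ a * 3 ^ b"
      using ab(2) by (cases b) auto
    also have "\<dots> = int (cert_m a b + 1)"
      by (simp only: cert_m_plus_1) simp
    finally show ?thesis by simp
  qed
  have "4 * int ?p = ?L\<^sup>2 + 3 * (3 * ?M)\<^sup>2"
    unfolding M by (simp add: cert_p_def power2_eq_square algebra_simps)
  then have form: "4 * int ?p = ?L\<^sup>2 + 27 * ?M\<^sup>2"
    by (simp add: power_mult_distrib)
  have "[?p = 1] (mod 3)"
    using d3 p7 unfolding cong_def by presburger
  then have "[7 ^ ((?p - 1) div 3) = 1] (mod int ?p) \<longleftrightarrow> 7 dvd ?L \<or> 7 dvd ?M"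
    using seven_cubic_residue_iff[OF p _ _ form] p7 by simp
  also have "\<dots> \<longleftrightarrow> 7 dvd int (3 * cert_m a b + 1)"
    using prime_dvd_power[of "7::int" 2 a] prime_dvd_power[of "7::int" 3 "b - 1"]
    by (auto simp: prime_dvd_mult_iff add.commute)
  also have "\<dots> \<longleftrightarrow> 7 dvd 3 * cert_m a b + 1"
    using int_dvd_int_iff[of 7 "3 * cert_m a b + 1"] by simp
  also have "\<dots> \<longleftrightarrow> [cert_m a b = 2] (mod 7)"
  proof -
    have "(3 * n + 1) mod 7 = 0 \<longleftrightarrow> n mod 7 = 2" for n :: nat
      by presburger
    then show ?thesis
      by (simp add: cong_def dvd_eq_mod_eq_0)
  qed
  finally have residue: "[7 ^ ((?p - 1) div 3) = 1] (mod int ?p) \<longleftrightarrow> [cert_m a b = 2] (mod 7)" .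
  have "\<not> int ?p dvd 7"
    using zdvd_imp_le[of "int ?p" 7] p7 by auto
  then have "coprime 7 (int ?p)"
    using coprime_prime_iff_int[OF p] by blast
  then show ?thesis
    using residue power_residue_iff[OF p d3, of 7]
    by (simp add: valid_witness_iff_power_nonresidue[OF p d3] power_nonresidue_def seven_case_def)
qed

text \<open>The search runs the test on the fixed witness or on the primes in increasing order; in both
  cases it stops at the prescribed choice.\<close>
lemma choice_cases:
  assumes ab: "a \<ge> 1" "b \<ge> 1" and p: "prime (cert_p a b)"
  shows "valid_witness (cert_p a b) 2 (choice2 a b)" "search2 a b = Some (choice2 a b)"
    and "valid_witness (cert_p a b) 3 (choice3 a b)" "search3 a b = Some (choice3 a b)"
proof -
  note d = dvd_cert_p_minus_1[OF ab(1), of b]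
  have least: "least_quadratic_nonresidue (cert_p a b) = least_power_nonresidue (cert_p a b) 2"
    "least_cubic_nonresidue (cert_p a b) = least_power_nonresidue (cert_p a b) 3"
    by (simp_all add: least_quadratic_nonresidue_def least_cubic_nonresidue_def
        least_power_nonresidue_def quadratic_nonresidue_eq cubic_nonresidue_eq)
  show "valid_witness (cert_p a b) 2 (choice2 a b)"
    using valid_witness_5_iff[OF assms] least_power_nonresidue(1)[OF p d(1)]
    by (simp add: choice2_def least valid_witness_iff_power_nonresidue[OF p d(1)])
  show "valid_witness (cert_p a b) 3 (choice3 a b)"
    using valid_witness_7_iff[OF assms] least_power_nonresidue(1)[OF p d(2)]
    by (simp add: choice3_def least valid_witness_iff_power_nonresidue[OF p d(2)])
  show "search2 a b = Some (choice2 a b)"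
    using valid_witness_5_iff[OF assms] prime_search_eq_least_power_nonresidue[OF p d(1)]
    by (simp add: search2_def choice2_def least)
  show "search3 a b = Some (choice3 a b)"
    using valid_witness_7_iff[OF assms] prime_search_eq_least_power_nonresidue[OF p d(2)]
    by (simp add: search3_def choice3_def least)
qed

lemma search_valid:
  "search2 a b = Some w \<Longrightarrow> valid_witness (cert_p a b) 2 w"
  "search3 a b = Some w \<Longrightarrow> valid_witness (cert_p a b) 3 w"
  by (auto simp: search2_def search3_def prime_search_def find_Some_iff split: if_splits)

lemma five_case_periodic:
  assumes "[a = a'] (mod 12)" "[b = b'] (mod 12)"
  shows "five_case a b \<longleftrightarrow> five_case a' b'"
proof -
  have "[a = a'] (mod 4)" "[b = b'] (mod 4)"
    using assms by (auto elim: cong_dvd_modulus_nat)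
  then have "[int a - int b = int a' - int b'] (mod 4)"
    by (intro cong_diff) (metis cong_int_iff of_nat_numeral)+
  then show ?thesis
    by (simp add: five_case_def cong_def)
qed

lemma seven_case_periodic:
  assumes "[a = a'] (mod 12)" "[b = b'] (mod 12)"
  shows "seven_case a b \<longleftrightarrow> seven_case a' b'"
proof -
  have "[2 ^ a = 2 ^ a'] (mod (7::nat))" "[3 ^ b = 3 ^ b'] (mod (7::nat))"
    using assms power_mod_period[of 2 12 7 a] power_mod_period[of 2 12 7 a']
      power_mod_period[of 3 12 7 b] power_mod_period[of 3 12 7 b'] by (simp_all add: cong_def)
  then have "[cert_m a b + 1 = cert_m a' b' + 1] (mod 7)"
    unfolding cert_m_plus_1 by (rule cong_mult)
  then have "[cert_m a b = cert_m a' b'] (mod 7)"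
    by (simp only: cong_add_rcancel_nat)
  then show ?thesis
    by (simp add: seven_case_def cong_def)
qed

lemma prime_919: "prime (919::nat)"
proof (rule prime_prime_factor_sqrt[THEN iffD2], intro conjI notI)
  assume "\<exists>r. prime r \<and> r dvd 919 \<and> r\<^sup>2 \<le> (919::nat)"
  then obtain r :: nat where r: "prime r" "r dvd 919" "r\<^sup>2 \<le> 919" by blast
  have "r < 31"
  proof (rule ccontr)
    assume "\<not> r < 31"
    then have "31 * 31 \<le> r * r"
      by (intro mult_mono) auto
    with r(3) show False
      by (simp add: power2_eq_square)
  qed
  then have "r \<in> set [2..<31]"
    unfolding set_upt using prime_ge_2_nat[OF r(1)] by (simp only: atLeastLessThan_iff)
  moreover have "\<forall>r\<in>set [2..<31]. \<not> r dvd (919::nat)"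
    by code_simp
  ultimately show False
    using r(2) by blast
qed simp_all

lemma cubic_nonresidue_density:
  assumes p: "prime p" "3 dvd p - 1" "p > 2"
  shows "real (card {x \<in> Units (residue_ring (int p)). cubic_nonresidue p x})
    / real (card (Units (residue_ring (int p)))) = 2 / 3"
proof -
  interpret residues_prime p "residue_ring (int p)"
    using p(1) prime_gt_1_nat by unfold_locales auto
  let ?U = "{1..int p - 1}"
  let ?C = "{x \<in> ?U. \<exists>y. [y ^ 3 = x] (mod int p)}"
  obtain r where r: "p - 1 = 3 * r"
    using p(2) by blast
  have "r > 0"
    using r p(3) by (auto intro: Nat.gr0I)
  have eq: "{x \<in> ?U. cubic_nonresidue p x} = ?U - ?C"
  proof -
    have "coprime x (int p)" if "x \<in> ?U" for x
      using that coprime_prime_iff_int[OF p(1), of x] zdvd_imp_le[of "int p" x] by auto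
    then show ?thesis
      by (auto simp only: cubic_nonresidue_def)
  qed
  have "card {x \<in> ?U. cubic_nonresidue p x} = card ?U - card ?C"
  proof -
    have "?C \<subseteq> ?U" by blast
    moreover have "finite ?C"
      by (rule finite_subset[OF \<open>?C \<subseteq> ?U\<close>]) simp
    ultimately show ?thesis
      using card_Diff_subset[of ?C ?U] unfolding eq by blast
  qed
  also have "\<dots> = 2 * r"
    using card_power_residues[OF p(1,2)] r by (simp add: nat_diff_distrib)
  finally have "card {x \<in> ?U. cubic_nonresidue p x} = 2 * r" .
  moreover have "card ?U = 3 * r"
    using r by (simp add: nat_diff_distrib)
  ultimately show ?thesis
    unfolding res_prime_units_eq using \<open>r > 0\<close> by simp
qed

theorem corollary4p9:
  shows
    "\<not> (\<forall>a\<ge>1. \<forall>b\<ge>1. prime (cert_p a b) \<longrightarrow> valid_pair (cert_p a b) 5 7)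
     \<and>
     (\<forall>a\<ge>1. \<forall>b\<ge>1. prime (cert_p a b) \<longrightarrow>
        (valid_pair (cert_p a b) 5 7 \<longleftrightarrow>
           ([int a - int b = 1] (mod 4) \<or> [int a - int b = 2] (mod 4)) \<and>
           \<not> [cert_m a b = 2] (mod 7)))
     \<and>
     ((\<forall>a\<ge>1. \<forall>b\<ge>1. prime (cert_p a b) \<longrightarrow>
         valid_pair (cert_p a b) (choice2 a b) (choice3 a b)) \<and>
      (\<forall>a\<ge>1. \<forall>b\<ge>1. \<forall>a'\<ge>1. \<forall>b'\<ge>1. [a = a'] (mod 12) \<and> [b = b'] (mod 12) \<longrightarrow>
         (five_case a b \<longleftrightarrow> five_case a' b') \<and> (seven_case a b \<longleftrightarrow> seven_case a' b')))
     \<and>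
     (\<forall>a\<ge>1. \<forall>b\<ge>1. prime (cert_p a b) \<and> [cert_m a b = 2] (mod 7) \<longrightarrow>
        real (card {x \<in> Units (residue_ring (int (cert_p a b))). cubic_nonresidue (cert_p a b) x})
          / real (card (Units (residue_ring (int (cert_p a b))))) = 2 / 3 \<and>
        (\<exists>l::nat. prime_search (cert_p a b) 3 = Some (int l) \<and>
           prime l \<and> l \<le> (cert_p a b - 1) div 3 + 1 \<and> cubic_nonresidue (cert_p a b) (int l)))
     \<and>
     (\<forall>a\<ge>1. \<forall>b\<ge>1.
        (prime (cert_p a b) \<longrightarrow> cert_search a b = Some (choice2 a b, choice3 a b)) \<and>
        (\<forall>w2 w3. cert_search a b = Some (w2, w3) \<longrightarrow>
           valid_pair (cert_p a b) w2 w3 \<and> prime (cert_p a b)))"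
proof (intro conjI allI impI)
  show "\<not> (\<forall>a\<ge>1. \<forall>b\<ge>1. prime (cert_p a b) \<longrightarrow> valid_pair (cert_p a b) 5 7)"
  proof
    assume all: "\<forall>a\<ge>1. \<forall>b\<ge>1. prime (cert_p a b) \<longrightarrow> valid_pair (cert_p a b) 5 7"
    \<comment> \<open>The smallest prime of this form with \<open>a - b\<close> congruent to 0 or 3 modulo 4.\<close>
    have "cert_p 1 2 = 919"
      by (simp add: cert_p_def cert_m_def)
    then have p: "prime (cert_p 1 2)"
      by (simp only: prime_919)
    then have "valid_pair (cert_p 1 2) 5 7"
      using all by simp
    then have "valid_witness (cert_p 1 2) 2 5"
      by (simp only: valid_pair_def)
    then have "five_case 1 2"
      using valid_witness_5_iff[OF _ _ p] by simp
    then show False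
      by (simp add: five_case_def cong_def)
  qed
next
  fix a b :: nat
  assume ab: "1 \<le> a" "1 \<le> b" and p: "prime (cert_p a b)"
  show "valid_pair (cert_p a b) 5 7 \<longleftrightarrow>
      ([int a - int b = 1] (mod 4) \<or> [int a - int b = 2] (mod 4)) \<and> \<not> [cert_m a b = 2] (mod 7)"
    using valid_witness_5_iff[OF ab p] valid_witness_7_iff[OF ab p]
    by (simp add: valid_pair_def five_case_def seven_case_def)
  show "valid_pair (cert_p a b) (choice2 a b) (choice3 a b)"
    using choice_cases[OF ab p] by (simp add: valid_pair_def)
  show "cert_search a b = Some (choice2 a b, choice3 a b)"
    using choice_cases[OF ab p] by (simp add: cert_search_def)
next
  fix a b a' b' :: nat
  assume "[a = a'] (mod 12) \<and> [b = b'] (mod 12)"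
  then show "five_case a b \<longleftrightarrow> five_case a' b'" "seven_case a b \<longleftrightarrow> seven_case a' b'"
    using five_case_periodic seven_case_periodic by blast+
next
  fix a b :: nat
  assume ab: "1 \<le> a" "1 \<le> b" and "prime (cert_p a b) \<and> [cert_m a b = 2] (mod 7)"
  then have p: "prime (cert_p a b)" by simp
  note d3 = dvd_cert_p_minus_1(2)[OF ab(1), of b]
  show "real (card {x \<in> Units (residue_ring (int (cert_p a b))). cubic_nonresidue (cert_p a b) x})
      / real (card (Units (residue_ring (int (cert_p a b))))) = 2 / 3"
    using cubic_nonresidue_density[OF p d3] cert_p_gt[OF ab] by simp
  show "\<exists>l. prime_search (cert_p a b) 3 = Some (int l) \<and>
      prime l \<and> l \<le> (cert_p a b - 1) div 3 + 1 \<and> cubic_nonresidue (cert_p a b) (int l)"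
    using prime_search_eq_least_power_nonresidue[OF p d3] least_power_nonresidue[OF p d3]
    by (auto simp: cubic_nonresidue_eq)
next
  fix a b :: nat and w2 w3 :: int
  assume ab: "1 \<le> a" "1 \<le> b" and "cert_search a b = Some (w2, w3)"
  then show "valid_pair (cert_p a b) w2 w3"
    using search_valid by (auto simp: cert_search_def valid_pair_def split: option.splits)
  then show "prime (cert_p a b)"
    using prime_cert_p_of_valid_pair[OF ab] by blast
qed

end
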